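(* Let $\Bbbk$ be a field of characteristic $0$ and $\mathbb{L}=\Bbbk(q)$. For all $n\ge 3$ and $r\ge 1$, the kernel of $R_{\mathrm{bur}}\circ\Delta_{n,r}:B_n\to GL_{nr}(\mathbb{L})$ (where $R_{\mathrm{bur}}$ is the Burau representation of $B_{nr}$) coincides with the kernel of the Burau representation $R_{\mathrm{bur}}:B_n\to GL_n(\mathbb{L})$ of $B_n$. In particular $R_{\mathrm{bur}}\circ\Delta_{n,r}$ is not faithful for $n\ge 5$.
   Context: $B_n$ is the braid group on $n$ strands with Artin generators $\sigma_1,\dots,\sigma_{n-1}$. Cabling: $\Delta_{n,r}:B_n\to B_{nr}$ is the group morphism replacing each strand by $r$ parallel strands (without twisting). Explicitly, $\Delta_{n,r}(\sigma_i)$ is the positive braid with $r^2$ crossings exchanging the $i$-th and $(i+1)$-st blocks of $r$ consecutive strands, i.e. $\Delta_{n,r}(\sigma_i)=\prod_{a=0}^{r-1}\left(\sigma_{ri+a}\sigma_{ri+a-1}\cdots\sigma_{ri+a-r+1}\right)$, the factors being written from left to right for increasing $a$. Burau representation: for $m\ge 2$, $R_{\mathrm{bur}}:B_m\to GL_m(\mathbb{L})$ is given in block-diagonal form by $$R_{\mathrm{bur}}(\sigma_i)=qI_{i-1}\oplus\begin{pmatrix} q-q^{-1}&q\\ q^{-1}&0\end{pmatrix}\oplus qI_{m-i-1}.$$ *)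

theory Defs
  imports
    "Jordan_Normal_Form.Matrix"
    "HOL-Algebra.Coset"
    "HOL-Computational_Algebra.Fraction_Field"
    "HOL-Computational_Algebra.Polynomial"
begin

section \<open>Groups given by generators and relations\<close>

text \<open>The letter \<open>(s, True)\<close> stands for the generator \<open>s\<close>, the letter \<open>(s, False)\<close> for its
  inverse. A relation is a pair of words.\<close>

type_synonym 'a gword = "('a \<times> bool) list"

definition gwords :: "'a set \<Rightarrow> 'a gword set" where
  "gwords S = lists (S \<times> UNIV)"

inductive pres_eq :: "'a set \<Rightarrow> ('a gword \<times> 'a gword) set \<Rightarrow> 'a gword \<Rightarrow> 'a gword \<Rightarrow> bool"
  for S R where
  refl: "w \<in> gwords S \<Longrightarrow> pres_eq S R w w"
| sym: "pres_eq S R u v \<Longrightarrow> pres_eq S R v u"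
| trans: "pres_eq S R u v \<Longrightarrow> pres_eq S R v w \<Longrightarrow> pres_eq S R u w"
| app: "pres_eq S R u u' \<Longrightarrow> pres_eq S R v v' \<Longrightarrow> pres_eq S R (u @ v) (u' @ v')"
| cancel: "s \<in> S \<Longrightarrow> pres_eq S R [(s, e), (s, \<not> e)] []"
| rel: "(u, v) \<in> R \<Longrightarrow> u \<in> gwords S \<Longrightarrow> v \<in> gwords S \<Longrightarrow> pres_eq S R u v"

definition pres_rel :: "'a set \<Rightarrow> ('a gword \<times> 'a gword) set \<Rightarrow> ('a gword \<times> 'a gword) set" where
  "pres_rel S R = {(u, v). pres_eq S R u v}"

definition pres_class :: "'a set \<Rightarrow> ('a gword \<times> 'a gword) set \<Rightarrow> 'a gword \<Rightarrow> 'a gword set" where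
  "pres_class S R w = pres_rel S R `` {w}"

definition presented_group :: "'a set \<Rightarrow> ('a gword \<times> 'a gword) set \<Rightarrow> 'a gword set monoid" where
  "presented_group S R =
    \<lparr> carrier = gwords S // pres_rel S R,
      mult = (\<lambda>A B. \<Union>u\<in>A. \<Union>v\<in>B. pres_class S R (u @ v)),
      one = pres_class S R [] \<rparr>"

fun gword_eval :: "('b, 'c) monoid_scheme \<Rightarrow> ('a \<Rightarrow> 'b) \<Rightarrow> 'a gword \<Rightarrow> 'b" where
  "gword_eval G f [] = \<one>\<^bsub>G\<^esub>"
| "gword_eval G f ((s, e) # w) = (if e then f s else inv\<^bsub>G\<^esub> (f s)) \<otimes>\<^bsub>G\<^esub> gword_eval G f w"

text \<open>The morphism out of a presented group determined by the images \<open>f\<close> of the generators. It is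
  meaningful only if \<open>f\<close> respects the relations; see \<open>presented_lift_hom\<close> below.\<close>

definition presented_lift :: "('b, 'c) monoid_scheme \<Rightarrow> ('a \<Rightarrow> 'b) \<Rightarrow> 'a gword set \<Rightarrow> 'b" where
  "presented_lift G f X = the_elem (gword_eval G f ` X)"

lemma gwords_simps [simp]:
  "[] \<in> gwords S"
  "x # w \<in> gwords S \<longleftrightarrow> fst x \<in> S \<and> w \<in> gwords S"
  "u @ v \<in> gwords S \<longleftrightarrow> u \<in> gwords S \<and> v \<in> gwords S"
  by (auto simp: gwords_def mem_Times_iff)

lemma pres_eq_gwords: "pres_eq S R u v \<Longrightarrow> u \<in> gwords S \<and> v \<in> gwords S"
  by (induction rule: pres_eq.induct) auto

lemma equiv_pres_rel: "equiv (gwords S) (pres_rel S R)"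
proof (rule equivI)
  show "pres_rel S R \<subseteq> gwords S \<times> gwords S"
    using pres_eq_gwords by (fastforce simp: pres_rel_def)
  show "refl_on (gwords S) (pres_rel S R)"
    by (auto simp: refl_on_def pres_rel_def intro: pres_eq.refl)
  show "sym (pres_rel S R)"
    by (auto simp: sym_def pres_rel_def intro: pres_eq.sym)
  show "trans (pres_rel S R)"
    unfolding trans_def pres_rel_def by (auto intro: pres_eq.trans)
qed

lemma pres_class_eq_iff:
  "u \<in> gwords S \<Longrightarrow> v \<in> gwords S \<Longrightarrow> pres_class S R u = pres_class S R v \<longleftrightarrow> pres_eq S R u v"
  unfolding pres_class_def using eq_equiv_class_iff[OF equiv_pres_rel, of u S v R]
  by (simp add: pres_rel_def)

lemma mem_pres_class: "v \<in> pres_class S R u \<longleftrightarrow> pres_eq S R u v"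
  by (auto simp: pres_class_def pres_rel_def)

lemma pres_class_carrier: "w \<in> gwords S \<Longrightarrow> pres_class S R w \<in> carrier (presented_group S R)"
  by (auto simp: presented_group_def pres_class_def quotient_def)

lemma presented_carrierE:
  assumes "X \<in> carrier (presented_group S R)"
  obtains w where "w \<in> gwords S" "X = pres_class S R w"
  using assms by (auto simp: presented_group_def pres_class_def quotient_def)

lemma pres_class_mult:
  assumes "u \<in> gwords S" "v \<in> gwords S"
  shows "pres_class S R u \<otimes>\<^bsub>presented_group S R\<^esub> pres_class S R v = pres_class S R (u @ v)"
proof -
  have "pres_class S R (u' @ v') = pres_class S R (u @ v)"
    if "pres_eq S R u u'" "pres_eq S R v v'" for u' v'
    using assms pres_eq_gwords[OF that(1)] pres_eq_gwords[OF that(2)]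
    by (subst pres_class_eq_iff) (auto intro!: pres_eq.app pres_eq.sym[OF that(1)] pres_eq.sym[OF that(2)])
  hence eq: "pres_class S R (u' @ v') = pres_class S R (u @ v)"
    if "u' \<in> pres_class S R u" "v' \<in> pres_class S R v" for u' v'
    using that by (simp add: mem_pres_class)
  have "u \<in> pres_class S R u" "v \<in> pres_class S R v"
    using assms by (auto simp: mem_pres_class intro: pres_eq.refl)
  hence "(\<Union>u'\<in>pres_class S R u. \<Union>v'\<in>pres_class S R v. pres_class S R (u' @ v')) = pres_class S R (u @ v)"
    using eq by blast
  thus ?thesis by (simp add: presented_group_def)
qed

lemma pres_eq_inverse:
  "w \<in> gwords S \<Longrightarrow> pres_eq S R (rev (map (\<lambda>(s, e). (s, \<not> e)) w) @ w) []"
proof (induction w)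
  case (Cons x w)
  obtain s e where x: "x = (s, e)" by (cases x)
  let ?I = "rev (map (\<lambda>(s, e). (s, \<not> e)) w)"
  have I: "?I \<in> gwords S"
    using Cons.prems by (auto simp: gwords_def in_lists_conv_set)
  have "pres_eq S R [(s, \<not> e), (s, e)] []"
    using pres_eq.cancel[of s S R "\<not> e"] Cons.prems x by simp
  hence "pres_eq S R (?I @ ([(s, \<not> e), (s, e)] @ w)) (?I @ ([] @ w))"
    using I Cons.prems by (intro pres_eq.app pres_eq.refl) auto
  moreover have "pres_eq S R (?I @ w) []"
    using Cons by simp
  ultimately show ?case
    by (simp add: x) (erule (1) pres_eq.trans)
qed (simp add: pres_eq.refl)

lemma group_presented: "group (presented_group S R)"
proof (rule groupI)
  show "\<one>\<^bsub>presented_group S R\<^esub> \<in> carrier (presented_group S R)"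
    using pres_class_carrier[of "[]"] by (simp add: presented_group_def)
next
  fix x y assume "x \<in> carrier (presented_group S R)" "y \<in> carrier (presented_group S R)"
  thus "x \<otimes>\<^bsub>presented_group S R\<^esub> y \<in> carrier (presented_group S R)"
    by (elim presented_carrierE) (auto simp: pres_class_mult intro: pres_class_carrier)
next
  fix x y z assume "x \<in> carrier (presented_group S R)" "y \<in> carrier (presented_group S R)"
    "z \<in> carrier (presented_group S R)"
  thus "x \<otimes>\<^bsub>presented_group S R\<^esub> y \<otimes>\<^bsub>presented_group S R\<^esub> z
      = x \<otimes>\<^bsub>presented_group S R\<^esub> (y \<otimes>\<^bsub>presented_group S R\<^esub> z)"
    by (elim presented_carrierE) (auto simp: pres_class_mult)
next
  have one: "\<one>\<^bsub>presented_group S R\<^esub> = pres_class S R []"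
    by (simp add: presented_group_def)
  fix x assume "x \<in> carrier (presented_group S R)"
  then obtain w where w: "w \<in> gwords S" "x = pres_class S R w"
    by (elim presented_carrierE)
  thus "\<one>\<^bsub>presented_group S R\<^esub> \<otimes>\<^bsub>presented_group S R\<^esub> x = x"
    by (simp add: one pres_class_mult)
  let ?I = "rev (map (\<lambda>(s, e). (s, \<not> e)) w)"
  have I: "?I \<in> gwords S"
    using w by (auto simp: gwords_def in_lists_conv_set)
  have "pres_class S R (?I @ w) = pres_class S R []"
    using w I by (subst pres_class_eq_iff) (auto intro: pres_eq_inverse)
  thus "\<exists>y\<in>carrier (presented_group S R). y \<otimes>\<^bsub>presented_group S R\<^esub> x = \<one>\<^bsub>presented_group S R\<^esub>"
    using w I one by (intro bexI[of _ "pres_class S R ?I"]) (auto simp: pres_class_mult intro: pres_class_carrier)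
qed

lemma gword_eval_closed:
  assumes "group G" "f \<in> S \<rightarrow> carrier G"
  shows "w \<in> gwords S \<Longrightarrow> gword_eval G f w \<in> carrier G"
proof (induction w)
  case Nil
  interpret group G by fact
  show ?case by simp
next
  case (Cons x w)
  interpret group G by fact
  obtain s e where x: "x = (s, e)" by (cases x)
  have "f s \<in> carrier G" using Cons.prems assms x by auto
  with Cons show ?case by (auto simp: x)
qed

lemma gword_eval_append:
  assumes "group G" "f \<in> S \<rightarrow> carrier G"
  shows "u \<in> gwords S \<Longrightarrow> v \<in> gwords S \<Longrightarrow>
    gword_eval G f (u @ v) = gword_eval G f u \<otimes>\<^bsub>G\<^esub> gword_eval G f v"
proof (induction u)
  case Nil
  interpret group G by fact
  show ?case using Nil gword_eval_closed[OF assms] by simp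
next
  case (Cons x u)
  interpret group G by fact
  obtain s e where x: "x = (s, e)" by (cases x)
  have "f s \<in> carrier G" using Cons assms x by auto
  moreover have "gword_eval G f u \<in> carrier G" "gword_eval G f v \<in> carrier G"
    using Cons.prems by (auto intro: gword_eval_closed[OF assms])
  ultimately show ?case using Cons by (auto simp: x m_assoc)
qed

lemma gword_eval_cong:
  assumes "group G" "f \<in> S \<rightarrow> carrier G"
    and R: "\<And>u v. (u, v) \<in> R \<Longrightarrow> u \<in> gwords S \<Longrightarrow> v \<in> gwords S \<Longrightarrow> gword_eval G f u = gword_eval G f v"
  shows "pres_eq S R u v \<Longrightarrow> gword_eval G f u = gword_eval G f v"
proof (induction rule: pres_eq.induct)
  case (app u u' v v')
  from app.hyps have "u \<in> gwords S" "u' \<in> gwords S" "v \<in> gwords S" "v' \<in> gwords S"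
    using pres_eq_gwords by blast+
  thus ?case using app.IH by (simp add: gword_eval_append[OF assms(1,2)])
next
  case (cancel s e)
  interpret group G by fact
  have "f s \<in> carrier G" using cancel assms by auto
  thus ?case by auto
qed (use R in auto)

lemma presented_lift_class:
  assumes "group G" "f \<in> S \<rightarrow> carrier G"
    and R: "\<And>u v. (u, v) \<in> R \<Longrightarrow> u \<in> gwords S \<Longrightarrow> v \<in> gwords S \<Longrightarrow> gword_eval G f u = gword_eval G f v"
    and w: "w \<in> gwords S"
  shows "presented_lift G f (pres_class S R w) = gword_eval G f w"
proof -
  have "gword_eval G f v = gword_eval G f w" if "v \<in> pres_class S R w" for v
    using gword_eval_cong[OF assms(1-3), symmetric] that unfolding mem_pres_class by blast
  moreover have "w \<in> pres_class S R w"
    using w by (auto simp: mem_pres_class intro: pres_eq.refl)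
  ultimately have "gword_eval G f ` pres_class S R w = {gword_eval G f w}" by blast
  thus ?thesis by (simp add: presented_lift_def)
qed

lemma presented_lift_hom:
  assumes "group G" "f \<in> S \<rightarrow> carrier G"
    and R: "\<And>u v. (u, v) \<in> R \<Longrightarrow> u \<in> gwords S \<Longrightarrow> v \<in> gwords S \<Longrightarrow> gword_eval G f u = gword_eval G f v"
  shows "presented_lift G f \<in> hom (presented_group S R) G"
proof (rule homI)
  fix x assume "x \<in> carrier (presented_group S R)"
  thus "presented_lift G f x \<in> carrier G"
    by (elim presented_carrierE)
      (simp add: presented_lift_class[OF assms] gword_eval_closed[OF assms(1,2)])
next
  fix x y assume "x \<in> carrier (presented_group S R)" "y \<in> carrier (presented_group S R)"
  thus "presented_lift G f (x \<otimes>\<^bsub>presented_group S R\<^esub> y) = presented_lift G f x \<otimes>\<^bsub>G\<^esub> presented_lift G f y"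
    by (elim presented_carrierE)
      (simp add: pres_class_mult presented_lift_class[OF assms] gword_eval_append[OF assms(1,2)])
qed


section \<open>Braid groups\<close>

abbreviation pos_word :: "nat list \<Rightarrow> nat gword" where
  "pos_word \<equiv> map (\<lambda>i. (i, True))"

definition braid_rels :: "nat \<Rightarrow> (nat gword \<times> nat gword) set" where
  "braid_rels n =
    {(pos_word [i, j], pos_word [j, i]) | i j. i \<in> {1..<n} \<and> j \<in> {1..<n} \<and> i + 2 \<le> j}
    \<union> {(pos_word [i, i + 1, i], pos_word [i + 1, i, i + 1]) | i. i \<in> {1..<n} \<and> i + 1 \<in> {1..<n}}"

type_synonym braid = "nat gword set"

definition braid_group :: "nat \<Rightarrow> braid monoid" where
  "braid_group n = presented_group {1..<n} (braid_rels n)"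

definition pos_braid :: "nat \<Rightarrow> nat list \<Rightarrow> braid" where
  "pos_braid n is = pres_class {1..<n} (braid_rels n) (pos_word is)"

definition braid_gen :: "nat \<Rightarrow> nat \<Rightarrow> braid" where
  "braid_gen n i = pos_braid n [i]"


section \<open>Cabling\<close>

text \<open>Indices of the descending product
  \<open>\<sigma>\<^bsub>x\<^esub> \<sigma>\<^bsub>x-1\<^esub> \<dots> \<sigma>\<^bsub>x-k+1\<^esub>\<close>, used only for \<open>k \<le> x\<close>.\<close>

definition descending :: "nat \<Rightarrow> nat \<Rightarrow> nat list" where
  "descending x k = map (\<lambda>b. x - b) [0..<k]"

definition cable_word :: "nat \<Rightarrow> nat \<Rightarrow> nat list" where
  "cable_word r i = concat (map (\<lambda>a. descending (r * i + a) r) [0..<r])"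

definition cabling :: "nat \<Rightarrow> nat \<Rightarrow> braid \<Rightarrow> braid" where
  "cabling n r = presented_lift (braid_group (n * r)) (\<lambda>i. pos_braid (n * r) (cable_word r i))"

lemma group_braid: "group (braid_group n)"
  by (simp add: braid_group_def group_presented)

lemma pos_word_gwords [simp]: "pos_word xs \<in> gwords S \<longleftrightarrow> set xs \<subseteq> S"
  by (auto simp: gwords_def in_lists_conv_set)

definition pos_eq :: "nat \<Rightarrow> nat list \<Rightarrow> nat list \<Rightarrow> bool" where
  "pos_eq m xs ys \<longleftrightarrow> pres_eq {1..<m} (braid_rels m) (pos_word xs) (pos_word ys)"

lemma pos_eq_refl: "set xs \<subseteq> {1..<m} \<Longrightarrow> pos_eq m xs xs"
  by (simp add: pos_eq_def pres_eq.refl)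

lemma pos_eq_sym: "pos_eq m xs ys \<Longrightarrow> pos_eq m ys xs"
  by (simp add: pos_eq_def pres_eq.sym)

lemma pos_eq_trans [trans]: "pos_eq m xs ys \<Longrightarrow> pos_eq m ys zs \<Longrightarrow> pos_eq m xs zs"
  unfolding pos_eq_def by (rule pres_eq.trans)

lemma pos_eq_append: "pos_eq m xs xs' \<Longrightarrow> pos_eq m ys ys' \<Longrightarrow> pos_eq m (xs @ ys) (xs' @ ys')"
  by (simp add: pos_eq_def pres_eq.app)

lemma pos_eq_subset: "pos_eq m xs ys \<Longrightarrow> set xs \<subseteq> {1..<m} \<and> set ys \<subseteq> {1..<m}"
  unfolding pos_eq_def by (drule pres_eq_gwords) simp

lemma pos_eq_context:
  "pos_eq m ys ys' \<Longrightarrow> set xs \<subseteq> {1..<m} \<Longrightarrow> set zs \<subseteq> {1..<m} \<Longrightarrow>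
    pos_eq m (xs @ ys @ zs) (xs @ ys' @ zs)"
  by (intro pos_eq_append pos_eq_refl)

lemma pos_eq_far:
  assumes "i \<in> {1..<m}" "j \<in> {1..<m}" "i + 2 \<le> j \<or> j + 2 \<le> i"
  shows "pos_eq m [i, j] [j, i]"
proof -
  have "pos_eq m [i, j] [j, i]" if "i \<in> {1..<m}" "j \<in> {1..<m}" "i + 2 \<le> j" for i j
    unfolding pos_eq_def using that by (intro pres_eq.rel) (auto simp: braid_rels_def)
  with assms show ?thesis by (meson pos_eq_sym)
qed

lemma pos_eq_braid:
  assumes "i \<in> {1..<m}" "i + 1 \<in> {1..<m}"
  shows "pos_eq m [i, i + 1, i] [i + 1, i, i + 1]"
  unfolding pos_eq_def using assms by (intro pres_eq.rel) (auto simp: braid_rels_def)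

lemma pos_eq_far_single:
  assumes "i \<in> {1..<m}" "set ys \<subseteq> {1..<m}" "\<And>j. j \<in> set ys \<Longrightarrow> i + 2 \<le> j \<or> j + 2 \<le> i"
  shows "pos_eq m (i # ys) (ys @ [i])"
  using assms(2,3)
proof (induction ys)
  case Nil
  thus ?case using assms(1) by (simp add: pos_eq_refl)
next
  case (Cons y ys)
  have "pos_eq m ([i, y] @ ys) ([y, i] @ ys)"
    using Cons.prems assms(1) by (intro pos_eq_append pos_eq_refl pos_eq_far) auto
  also have "pos_eq m ([y] @ (i # ys)) ([y] @ (ys @ [i]))"
    using Cons by (intro pos_eq_append pos_eq_refl Cons.IH) auto
  hence "pos_eq m ([y, i] @ ys) ([y] @ (ys @ [i]))" by simp
  finally show ?case by simp
qed

lemma pos_eq_far_list: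
  assumes "set xs \<subseteq> {1..<m}" "set ys \<subseteq> {1..<m}"
    "\<And>i j. i \<in> set xs \<Longrightarrow> j \<in> set ys \<Longrightarrow> i + 2 \<le> j \<or> j + 2 \<le> i"
  shows "pos_eq m (xs @ ys) (ys @ xs)"
  using assms(1,3)
proof (induction xs)
  case Nil
  thus ?case using assms(2) by (simp add: pos_eq_refl)
next
  case (Cons x xs)
  have "pos_eq m ([x] @ (xs @ ys)) ([x] @ (ys @ xs))"
    using Cons by (intro pos_eq_append pos_eq_refl Cons.IH) auto
  also have "pos_eq m ((x # ys) @ xs) ((ys @ [x]) @ xs)"
    using Cons.prems assms(2) by (intro pos_eq_append pos_eq_refl pos_eq_far_single) auto
  hence "pos_eq m ([x] @ (ys @ xs)) ((ys @ [x]) @ xs)" by simp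
  finally show ?case by simp
qed

lemma descending_simps [simp]:
  "descending x 0 = []"
  "descending x (Suc k) = descending x k @ [x - k]"
  by (simp_all add: descending_def)

lemma set_descending: "k \<le> x \<Longrightarrow> set (descending x k) = {x + 1 - k..x}"
proof (induction k)
  case (Suc k)
  hence "set (descending x (Suc k)) = insert (x - k) {x + 1 - k..x}" by simp
  also have "\<dots> = {x + 1 - Suc k..x}" using Suc.prems by auto
  finally show ?case .
qed simp

lemma descending_append:
  "l \<le> x \<Longrightarrow> descending x l @ descending (x - l) k = descending x (l + k)"
  by (induction k) (simp_all add: diff_diff_left)

lemma descending_shift:
  assumes "k \<le> x" "x < m" "x + 1 < j + k" "j \<le> x"
  shows "pos_eq m (descending x k @ [j]) ((j - 1) # descending x k)"
  using assms(1,3)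
proof (induction k)
  case 0
  thus ?case using assms by simp
next
  case (Suc k)
  have sub: "set (descending x k) \<subseteq> {1..<m}"
    using Suc.prems assms(2) by (auto simp: set_descending)
  show ?case
  proof (cases "x + 1 < j + k")
    case True
    have "pos_eq m (descending x k @ [x - k, j]) (descending x k @ [j, x - k])"
      using sub True Suc.prems assms(2,4) by (intro pos_eq_append pos_eq_refl pos_eq_far) auto
    also have "pos_eq m ((descending x k @ [j]) @ [x - k]) (((j - 1) # descending x k) @ [x - k])"
      using True Suc.prems assms(2) by (intro pos_eq_append Suc.IH pos_eq_refl) auto
    hence "pos_eq m (descending x k @ [j, x - k]) ((j - 1) # descending x (Suc k))" by simp
    finally show ?thesis by simp
  next
    case False
    hence j: "j = x + 1 - k" using Suc.prems by auto
    with assms(4) obtain l where l: "k = Suc l" by (cases k) auto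
    let ?D = "descending x l"
    have D: "set ?D \<subseteq> {1..<m}" "\<And>y. y \<in> set ?D \<Longrightarrow> j + 1 \<le> y"
      using Suc.prems assms(2) l j by (auto simp: set_descending)
    have jj: "j - 1 \<in> {1..<m}" "j \<in> {1..<m}" "x - l = j" "x - k = j - 1" "j - 1 + 1 = j"
      using Suc.prems j l assms(2) by auto
    have "pos_eq m [j - 1, j - 1 + 1, j - 1] [j - 1 + 1, j - 1, j - 1 + 1]"
      using jj by (intro pos_eq_braid) auto
    hence "pos_eq m [j, j - 1, j] [j - 1, j, j - 1]" unfolding jj(5) by (rule pos_eq_sym)
    hence "pos_eq m (?D @ [j, j - 1, j]) (?D @ [j - 1, j, j - 1])"
      using D by (intro pos_eq_append pos_eq_refl)
    also have "pos_eq m ((?D @ [j - 1]) @ [j, j - 1]) (((j - 1) # ?D) @ [j, j - 1])"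
      using D jj by (intro pos_eq_append pos_eq_refl pos_eq_sym[OF pos_eq_far_single]) fastforce+
    hence "pos_eq m (?D @ [j - 1, j, j - 1]) ((j - 1) # ?D @ [j, j - 1])" by simp
    finally show ?thesis unfolding l using jj l by simp
  qed
qed

definition block_word :: "nat \<Rightarrow> nat \<Rightarrow> nat \<Rightarrow> nat list" where
  "block_word p k c = concat (map (\<lambda>a. descending (p + a) k) [0..<c])"

lemma block_word_simps [simp]:
  "block_word p k 0 = []"
  "block_word p k (Suc c) = block_word p k c @ descending (p + c) k"
  by (simp_all add: block_word_def)

lemma cable_word_eq: "cable_word r i = block_word (r * i) r r"
  by (simp add: cable_word_def block_word_def)

lemma set_block_word: "k \<le> p \<Longrightarrow> set (block_word p k c) \<subseteq> {p + 1 - k..<p + c}"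
proof (induction c)
  case (Suc c)
  have "set (descending (p + c) k) \<subseteq> {p + 1 - k..<p + Suc c}"
    using Suc.prems by (subst set_descending) auto
  moreover have "{p + 1 - k..<p + c} \<subseteq> {p + 1 - k..<p + Suc c}" by auto
  ultimately show ?case using Suc by auto
qed simp

lemma block_word_sub:
  "k \<le> p \<Longrightarrow> p + c \<le> m \<Longrightarrow> set (block_word p k c) \<subseteq> {1..<m}"
  by (rule order_trans[OF set_block_word]) auto

lemma block_word_shift_single:
  assumes "k \<le> p" "p + c \<le> m" "p + c < j + k" "j < p + c"
  shows "pos_eq m (block_word p k c @ [j]) ((j - c) # block_word p k c)"
  using assms(2-4)
proof (induction c arbitrary: j)
  case 0
  thus ?case using assms by simp (rule pos_eq_refl, auto)
next
  case (Suc c)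
  have sub: "set (block_word p k c) \<subseteq> {1..<m}"
    using Suc.prems assms(1) by (intro block_word_sub) auto
  have "pos_eq m (block_word p k c @ (descending (p + c) k @ [j]))
      (block_word p k c @ ((j - 1) # descending (p + c) k))"
    using Suc.prems assms(1) sub by (intro pos_eq_append pos_eq_refl descending_shift) auto
  also have "pos_eq m ((block_word p k c @ [j - 1]) @ descending (p + c) k)
      (((j - 1 - c) # block_word p k c) @ descending (p + c) k)"
  proof (cases "c = 0")
    case True
    have "set (descending p k) \<subseteq> {1..<m}" using assms(1) Suc.prems by (auto simp: set_descending)
    moreover have "j - 1 \<in> {1..<m}" using True assms(1) Suc.prems by auto
    ultimately show ?thesis using True by (simp add: pos_eq_refl)
  next
    case False
    have "set (descending (p + c) k) \<subseteq> {1..<m}"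
      using assms(1) Suc.prems by (auto simp: set_descending)
    thus ?thesis using False Suc.prems assms(1) by (intro pos_eq_append pos_eq_refl Suc.IH) auto
  qed
  hence "pos_eq m (block_word p k c @ ((j - 1) # descending (p + c) k))
      ((j - Suc c) # block_word p k (Suc c))" by simp
  finally show ?case by simp
qed

lemma block_word_shift:
  assumes "k \<le> p" "p + c \<le> m" "\<And>j. j \<in> set ys \<Longrightarrow> p + c < j + k \<and> j < p + c"
  shows "pos_eq m (block_word p k c @ ys) (map (\<lambda>j. j - c) ys @ block_word p k c)"
  using assms(3)
proof (induction ys)
  case Nil
  show ?case using block_word_sub[OF assms(1,2)] by (simp add: pos_eq_refl)
next
  case (Cons y ys)
  have ys: "set ys \<subseteq> {1..<m}" using Cons.prems assms(1,2) by fastforce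
  have "pos_eq m ((block_word p k c @ [y]) @ ys) (((y - c) # block_word p k c) @ ys)"
    using Cons.prems ys assms(1,2) by (intro pos_eq_append pos_eq_refl block_word_shift_single) auto
  also have "pos_eq m ([y - c] @ (block_word p k c @ ys))
      ([y - c] @ (map (\<lambda>j. j - c) ys @ block_word p k c))"
  proof (rule pos_eq_append[OF pos_eq_refl])
    show "set [y - c] \<subseteq> {1..<m}" using Cons.prems[of y] assms(1,2) by auto
    show "pos_eq m (block_word p k c @ ys) (map (\<lambda>j. j - c) ys @ block_word p k c)"
      using Cons.prems by (intro Cons.IH) auto
  qed
  hence "pos_eq m (((y - c) # block_word p k c) @ ys)
      ([y - c] @ (map (\<lambda>j. j - c) ys @ block_word p k c))" by simp
  finally show ?case by simp
qed

lemma block_word_merge: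
  assumes "k \<le> p" "p + l + c \<le> m" "c \<le> l"
  shows "pos_eq m (block_word (p + l) l c @ block_word p k c) (block_word (p + l) (l + k) c)"
  using assms(2,3)
proof (induction c)
  case 0
  thus ?case by (simp add: pos_eq_refl)
next
  case (Suc c)
  let ?A = "block_word (p + l) l c" and ?B = "block_word p k c"
  let ?d = "descending (p + l + c) l" and ?e = "descending (p + c) k"
  have subs: "set ?A \<subseteq> {1..<m}" "set ?B \<subseteq> {1..<m}"
    using Suc.prems assms(1) by (intro block_word_sub; simp)+
  have subd: "set ?d \<subseteq> {1..<m}" "set ?e \<subseteq> {1..<m}" "set ?d \<subseteq> {p + c + 1..}"
    using Suc.prems assms(1) by (auto simp: set_descending)
  have subB: "set ?B \<subseteq> {..<p + c}" using set_block_word[OF assms(1), of c] by auto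
  have "pos_eq m (?A @ (?d @ ?B) @ ?e) (?A @ (?B @ ?d) @ ?e)"
    using subs subd subB by (intro pos_eq_context pos_eq_far_list) fastforce+
  also have "pos_eq m ((?A @ ?B) @ (?d @ ?e)) (block_word (p + l) (l + k) c @ (?d @ ?e))"
    using subs subd Suc by (intro pos_eq_append[OF Suc.IH] pos_eq_refl) auto
  hence "pos_eq m (?A @ (?B @ ?d) @ ?e) (block_word (p + l) (l + k) c @ (?d @ ?e))" by simp
  also have "?d @ ?e = descending (p + l + c) (l + k)"
    using descending_append[of l "p + l + c" k] by simp
  finally show ?case by simp
qed

lemma map_descending: "k + c \<le> x \<Longrightarrow> map (\<lambda>j. j - c) (descending x k) = descending (x - c) k"
  by (auto simp: descending_def)

lemma map_block_word:
  "k \<le> p \<Longrightarrow> map (\<lambda>j. j - d) (block_word (p + d) k c) = block_word p k c"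
  by (induction c) (simp_all add: map_descending)

lemma cable_sub:
  assumes "i \<in> {1..<n}"
  shows "set (cable_word r i) \<subseteq> {1..<n * r}"
  unfolding cable_word_eq
proof (rule block_word_sub)
  show "r \<le> r * i" using assms by simp
  have "r * (i + 1) \<le> r * n" using assms by (intro mult_le_mono2) auto
  thus "r * i + r \<le> n * r" by (simp add: algebra_simps)
qed

lemma cable_far:
  assumes "i \<in> {1..<n}" "j \<in> {1..<n}" "i + 2 \<le> j"
  shows "pos_eq (n * r) (cable_word r i @ cable_word r j) (cable_word r j @ cable_word r i)"
proof (rule pos_eq_far_list)
  fix a b assume "a \<in> set (cable_word r i)" "b \<in> set (cable_word r j)"
  hence "a < r * i + r" "r * j + 1 - r \<le> b"
    using set_block_word[of r "r * i" r] set_block_word[of r "r * j" r] assms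
    by (auto simp: cable_word_eq)
  moreover have "r * (i + 2) \<le> r * j" using assms by (intro mult_le_mono2) auto
  hence "r * i + 2 * r \<le> r * j" by (simp add: algebra_simps)
  ultimately show "a + 2 \<le> b \<or> b + 2 \<le> a" by linarith
qed (use assms cable_sub in auto)

lemma cable_braid:
  assumes "i \<in> {1..<n}" "i + 1 \<in> {1..<n}"
  shows "pos_eq (n * r) (cable_word r i @ cable_word r (i + 1) @ cable_word r i)
    (cable_word r (i + 1) @ cable_word r i @ cable_word r (i + 1))"
proof -
  define p where "p = r * i"
  let ?X = "block_word p r r" and ?Y = "block_word (p + r) r r"
  have eq: "cable_word r i = ?X" "cable_word r (i + 1) = ?Y"
    by (simp_all add: cable_word_eq p_def add.commute)
  have p: "r \<le> p" using assms by (simp add: p_def)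
  have "r * (i + 2) \<le> r * n" using assms by (intro mult_le_mono2) auto
  hence m: "p + r + r \<le> n * r" by (simp add: p_def algebra_simps)
  have X: "set ?X \<subseteq> {1..<n * r}" and Y: "set ?Y \<subseteq> {1..<n * r}"
    using p m by (intro block_word_sub; simp)+
  let ?Z = "block_word (p + r) (r + r) r"
  have merge: "pos_eq (n * r) (?Y @ ?X) ?Z"
    using p m by (intro block_word_merge) auto
  have "pos_eq (n * r) ((?Y @ ?X) @ ?Y) (?Z @ ?Y)"
    using merge Y by (intro pos_eq_append pos_eq_refl)
  also have "pos_eq (n * r) (?Z @ ?Y) (map (\<lambda>j. j - r) ?Y @ ?Z)"
    using p m set_block_word[of r "p + r" r] by (intro block_word_shift) fastforce+
  also have "map (\<lambda>j. j - r) ?Y = ?X" using p by (rule map_block_word)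
  also have "pos_eq (n * r) (?X @ ?Z) (?X @ (?Y @ ?X))"
    using merge X by (intro pos_eq_append pos_eq_refl pos_eq_sym[OF merge])
  finally have "pos_eq (n * r) (?Y @ ?X @ ?Y) (?X @ ?Y @ ?X)" by simp
  thus ?thesis unfolding eq by (rule pos_eq_sym)
qed

lemma pos_braid_carrier: "set xs \<subseteq> {1..<m} \<Longrightarrow> pos_braid m xs \<in> carrier (braid_group m)"
  by (simp add: pos_braid_def braid_group_def pres_class_carrier)

lemma pos_braid_mult:
  "set xs \<subseteq> {1..<m} \<Longrightarrow> set ys \<subseteq> {1..<m} \<Longrightarrow>
    pos_braid m xs \<otimes>\<^bsub>braid_group m\<^esub> pos_braid m ys = pos_braid m (xs @ ys)"
  by (simp add: pos_braid_def braid_group_def pres_class_mult)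

lemma pos_braid_eq: "pos_eq m xs ys \<Longrightarrow> pos_braid m xs = pos_braid m ys"
  using pos_eq_subset[of m xs ys] by (simp add: pos_braid_def pos_eq_def pres_class_eq_iff)

lemma cable_closed:
  "(\<lambda>i. pos_braid (n * r) (cable_word r i)) \<in> {1..<n} \<rightarrow> carrier (braid_group (n * r))"
  by (intro funcsetI pos_braid_carrier cable_sub)

lemma cable_respects:
  assumes "(u, v) \<in> braid_rels n"
  shows "gword_eval (braid_group (n * r)) (\<lambda>i. pos_braid (n * r) (cable_word r i)) u
    = gword_eval (braid_group (n * r)) (\<lambda>i. pos_braid (n * r) (cable_word r i)) v"
proof -
  interpret group "braid_group (n * r)" by (rule group_braid)
  from assms consider
      i j where "u = pos_word [i, j]" "v = pos_word [j, i]" "i \<in> {1..<n}" "j \<in> {1..<n}" "i + 2 \<le> j"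
    | i where "u = pos_word [i, i + 1, i]" "v = pos_word [i + 1, i, i + 1]"
        "i \<in> {1..<n}" "i + 1 \<in> {1..<n}"
    unfolding braid_rels_def by blast
  thus ?thesis
  proof cases
    case 1
    note sub = cable_sub[OF 1(3), of r] cable_sub[OF 1(4), of r]
    show ?thesis
      using pos_braid_eq[OF cable_far[OF 1(3-5), of r]] sub[THEN pos_braid_carrier]
        pos_braid_mult[OF sub] pos_braid_mult[OF sub(2,1)]
      by (simp add: 1(1,2))
  next
    case 2
    note sub = cable_sub[OF 2(3), of r] cable_sub[OF 2(4), of r]
    let ?x = "cable_word r i" and ?y = "cable_word r (i + 1)"
    have "set (?y @ ?x) \<subseteq> {1..<n * r}" "set (?x @ ?y) \<subseteq> {1..<n * r}" using sub by auto
    thus ?thesis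
      using pos_braid_eq[OF cable_braid[OF 2(3,4), of r]] sub[THEN pos_braid_carrier]
        pos_braid_mult[OF sub] pos_braid_mult[OF sub(2,1)]
        pos_braid_mult[OF sub(1), of "?y @ ?x"] pos_braid_mult[OF sub(2), of "?x @ ?y"]
      by (simp add: 2(1,2))
  qed
qed

lemma cabling_hom: "cabling n r \<in> hom (braid_group n) (braid_group (n * r))"
  unfolding cabling_def braid_group_def[of n]
  by (intro presented_lift_hom group_braid cable_closed cable_respects)

lemma cabling_gen:
  "i \<in> {1..<n} \<Longrightarrow> cabling n r (braid_gen n i) = pos_braid (n * r) (cable_word r i)"
  unfolding cabling_def braid_gen_def pos_braid_def[of n]
  using pos_braid_carrier[OF cable_sub[of i n r]] group.is_monoid[OF group_braid]
  by (subst presented_lift_class[OF group_braid cable_closed cable_respects])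
    (auto simp: monoid.r_one)



section \<open>Burau representation\<close>

definition GL :: "nat \<Rightarrow> 'a :: field mat monoid" where
  "GL m = units_of (ring_mat TYPE('a) m ())"

text \<open>The field \<open>\<bbbk>(q)\<close> is the fraction field \<open>'k poly fract\<close> of the polynomial ring.\<close>

definition qvar :: "'k :: field poly fract" where
  "qvar = Fract [:0, 1:] 1"

definition burau_gen :: "nat \<Rightarrow> nat \<Rightarrow> 'k :: field poly fract mat" where
  "burau_gen m i = diag_block_mat
    [qvar \<cdot>\<^sub>m 1\<^sub>m (i - 1),
     mat_of_rows_list 2 [[qvar - inverse qvar, qvar], [inverse qvar, 0]],
     qvar \<cdot>\<^sub>m 1\<^sub>m (m - i - 1)]"

definition burau :: "nat \<Rightarrow> braid \<Rightarrow> 'k :: field poly fract mat" where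
  "burau m = presented_lift (GL m) (burau_gen m)"

lemma group_GL: "group (GL m :: 'a :: field mat monoid)"
  unfolding GL_def by (rule monoid.units_group) (rule ring.is_monoid[OF ring_mat])

lemma qvar_nonzero: "qvar \<noteq> (0 :: 'k :: field poly fract)"
  by (simp add: qvar_def Zero_fract_def eq_fract)

definition local_mat :: "nat \<Rightarrow> nat \<Rightarrow> 'a \<Rightarrow> 'a \<Rightarrow> 'a \<Rightarrow> 'a \<Rightarrow> 'a \<Rightarrow> 'a :: field mat" where
  "local_mat m i c d e f s = mat m m (\<lambda>(a, b).
    if a = i - 1 then (if b = i - 1 then c else 0) + (if b = i then d else 0)
    else if a = i then (if b = i - 1 then e else 0) + (if b = i then f else 0)
    else if b = a then s else 0)"

lemma local_mat_carrier [simp]: "local_mat m i c d e f s \<in> carrier_mat m m"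
  "dim_row (local_mat m i c d e f s) = m" "dim_col (local_mat m i c d e f s) = m"
  by (simp_all add: local_mat_def)

lemma local_mat_mult_index:
  assumes "i \<in> {1..<m}" "dim_row A = m" "dim_col A = m" "a < m" "b < m"
  shows "(local_mat m i c d e f s * A) $$ (a, b) =
    (if a = i - 1 then c * A $$ (i - 1, b) + d * A $$ (i, b)
     else if a = i then e * A $$ (i - 1, b) + f * A $$ (i, b)
     else s * A $$ (a, b))"
proof -
  have i: "i - 1 < m" "i < m" using assms by auto
  have "(local_mat m i c d e f s * A) $$ (a, b)
      = (\<Sum>k = 0..<m. local_mat m i c d e f s $$ (a, k) * A $$ (k, b))"
    using assms by (simp add: scalar_prod_def)
  also have "\<dots> = (\<Sum>k = 0..<m.
      (if a = i - 1 then (if k = i - 1 then c else 0) + (if k = i then d else 0)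
       else if a = i then (if k = i - 1 then e else 0) + (if k = i then f else 0)
       else if k = a then s else 0) * A $$ (k, b))"
    using assms by (intro sum.cong) (auto simp: local_mat_def)
  also have "\<dots> =
    (if a = i - 1 then c * A $$ (i - 1, b) + d * A $$ (i, b)
     else if a = i then e * A $$ (i - 1, b) + f * A $$ (i, b)
     else s * A $$ (a, b))"
    using i assms(4)
    by (simp add: distrib_right sum.distrib if_distrib[of "\<lambda>x. x * _"] cong: if_cong)
  finally show ?thesis .
qed

lemma burau_gen_eq:
  assumes "i \<in> {1..<m}"
  shows "burau_gen m i = local_mat m i (qvar - inverse qvar) qvar (inverse qvar) 0 qvar"
proof -
  obtain p where i: "i = Suc p" using assms by (cases i) auto
  obtain t where m: "m = p + (2 + t)" using assms i le_Suc_ex[of "p + 2" m] by auto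
  let ?B = "mat 2 2 (\<lambda>(a, b). [[qvar - inverse qvar, qvar], [inverse qvar, 0]] ! a ! b)"
  let ?D = "four_block_mat ?B (0\<^sub>m 2 t) (0\<^sub>m t 2) (qvar \<cdot>\<^sub>m 1\<^sub>m t)"
  have gen: "burau_gen m i
      = four_block_mat (qvar \<cdot>\<^sub>m 1\<^sub>m p) (0\<^sub>m p (2 + t)) (0\<^sub>m (2 + t) p) ?D"
    unfolding burau_gen_def diag_block_mat.simps(2)[of _ "_ # _"] diag_block_mat_singleton
    by (simp add: i m Let_def mat_of_rows_list_def numeral_2_eq_2)
  show ?thesis
  proof (rule eq_matI)
    fix a b
    assume "a < dim_row (local_mat m i (qvar - inverse qvar) qvar (inverse qvar) 0 qvar)"
      and "b < dim_col (local_mat m i (qvar - inverse qvar) qvar (inverse qvar) 0 qvar)"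
    hence ab: "a < p + (2 + t)" "b < p + (2 + t)" by (simp_all add: m)
    have cases: "x < p \<or> x = p \<or> x = Suc p \<or> p + 2 \<le> x" for x by linarith
    show "burau_gen m i $$ (a, b)
        = local_mat m i (qvar - inverse qvar) qvar (inverse qvar) 0 qvar $$ (a, b)"
      using ab cases[of a] cases[of b] unfolding gen by (auto simp: local_mat_def i m)
  qed (unfold gen, simp_all add: m)
qed

lemma local_mat_one_index:
  assumes "i \<in> {1..<m}" "a < m" "b < m"
  shows "local_mat m i c d e f s $$ (a, b) =
    (if a = i - 1 then c * 1\<^sub>m m $$ (i - 1, b) + d * 1\<^sub>m m $$ (i, b)
     else if a = i then e * 1\<^sub>m m $$ (i - 1, b) + f * 1\<^sub>m m $$ (i, b)
     else s * 1\<^sub>m m $$ (a, b))"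
  using local_mat_mult_index[OF assms(1), of "1\<^sub>m m" a b c d e f s] assms by simp

lemma GL_simps:
  "carrier (GL m) = Units (ring_mat TYPE('a :: field) m ())"
  "x \<otimes>\<^bsub>GL m\<^esub> y = x * (y :: 'a mat)"
  "\<one>\<^bsub>GL m\<^esub> = (1\<^sub>m m :: 'a mat)"
  by (simp_all add: GL_def units_of_def ring_mat_simps)

lemma burau_gen_closed:
  assumes "i \<in> {1..<m}"
  shows "burau_gen m i \<in> carrier (GL m)"
proof -
  let ?q = "qvar :: 'a poly fract"
  let ?M = "local_mat m i (?q - inverse ?q) ?q (inverse ?q) 0 ?q"
  let ?N = "local_mat m i 0 ?q (inverse ?q) (inverse ?q - ?q) (inverse ?q)"
  have i: "i - 1 < m" "i < m" "i - 1 \<noteq> i" using assms by auto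
  have "?N * ?M = 1\<^sub>m m"
    using assms i qvar_nonzero[where 'k = 'a]
    by (intro eq_matI) (auto simp: local_mat_mult_index local_mat_one_index algebra_simps
        simp del: index_mult_mat(1))
  moreover have "?M * ?N = 1\<^sub>m m"
    using assms i qvar_nonzero[where 'k = 'a]
    by (intro eq_matI) (auto simp: local_mat_mult_index local_mat_one_index algebra_simps
        simp del: index_mult_mat(1))
  ultimately show ?thesis
    unfolding GL_simps burau_gen_eq[OF assms] Units_def ring_mat_simps
    using local_mat_carrier(1) by blast
qed

lemma burau_respects:
  assumes "(u, v) \<in> braid_rels m"
  shows "gword_eval (GL m) (burau_gen m :: nat \<Rightarrow> 'k :: field poly fract mat) u
    = gword_eval (GL m) (burau_gen m) v"
proof -
  let ?q = "qvar :: 'k poly fract"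
  let ?M = "\<lambda>i. local_mat m i (?q - inverse ?q) ?q (inverse ?q) 0 ?q"
  note q = qvar_nonzero[where 'k = 'k]
  from assms consider
      i j where "u = pos_word [i, j]" "v = pos_word [j, i]" "i \<in> {1..<m}" "j \<in> {1..<m}" "i + 2 \<le> j"
    | i where "u = pos_word [i, i + 1, i]" "v = pos_word [i + 1, i, i + 1]"
        "i \<in> {1..<m}" "i + 1 \<in> {1..<m}"
    unfolding braid_rels_def by blast
  thus ?thesis
  proof cases
    case 1
    have ij: "i - 1 < m" "i < m" "i - 1 \<noteq> i" "j - 1 < m" "j < m" "j - 1 \<noteq> j"
      "i \<noteq> j" "i - 1 \<noteq> j - 1" "i \<noteq> j - 1" "i - 1 \<noteq> j" using 1 by auto
    have "?M i * (?M j * A) = ?M j * (?M i * A)" if "dim_row A = m" "dim_col A = m" for A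
      using that 1(3,4) ij ij(3,6-10)[THEN not_sym]
      by (intro eq_matI) (simp_all add: local_mat_mult_index algebra_simps del: index_mult_mat(1))
    from this[of "1\<^sub>m m"] show ?thesis by (simp add: 1 GL_simps burau_gen_eq[OF 1(3)] burau_gen_eq[OF 1(4)])
  next
    case 2
    have i: "i - 1 < m" "i < m" "i + 1 < m" "i - 1 \<noteq> i" "i - 1 \<noteq> i + 1" using 2 by auto
    have "?M i * (?M (i + 1) * (?M i * A)) = ?M (i + 1) * (?M i * (?M (i + 1) * A))"
      if "dim_row A = m" "dim_col A = m" for A
      using that 2(3,4) i i(4,5)[THEN not_sym] q
      by (intro eq_matI)
        (simp_all add: local_mat_mult_index algebra_simps del: index_mult_mat(1))
    from this[of "1\<^sub>m m"] show ?thesis by (simp add: 2 GL_simps burau_gen_eq[OF 2(3)] burau_gen_eq[OF 2(4), simplified])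
  qed
qed

lemma burau_hom: "burau m \<in> hom (braid_group m) (GL m :: 'k :: field poly fract mat monoid)"
  unfolding burau_def braid_group_def
  by (intro presented_lift_hom group_GL burau_respects funcsetI burau_gen_closed)

lemma burau_braid_gen:
  assumes "i \<in> {1..<m}"
  shows "burau m (braid_gen m i) = (burau_gen m i :: 'k :: field poly fract mat)"
proof -
  have "burau m (braid_gen m i) = gword_eval (GL m) (burau_gen m) [(i, True)]"
    unfolding burau_def braid_gen_def pos_braid_def using assms
    by (subst presented_lift_class[OF group_GL _ burau_respects])
      (auto intro: burau_gen_closed)
  thus ?thesis
    by (simp add: monoid.r_one[OF group.is_monoid[OF group_GL] burau_gen_closed[OF assms]])
qed

end

theory Submission
  imports Defs "Jordan_Normal_Form.Char_Poly"
begin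

text \<open>
On row vectors the Burau matrices are, up to powers of \<open>q\<close>, colourings by the Alexander quandle
\<open>a \<rhd> b = (1 - s) a + s b\<close> with \<open>s = q\<^sup>-\<^sup>2\<close>. When a whole block of \<open>r\<close> strands passes over a strand
coloured \<open>b\<close>, the composite of these affine maps is \<open>b \<mapsto> s\<^sup>r b + (1 - s\<^sup>r) m\<close>, where \<open>m\<close> is a weighted
mean of the colours of the block. Hence the cabled representation splits explicitly: the means of the
blocks transform by the Alexander quandle with parameter \<open>s\<^sup>r\<close>, and the deviation of each strand
from the mean of its block transforms monomially, picking up a factor \<open>s\<^sup>r\<close> whenever its block passes under
another block (\<open>block_cross\<close>, \<open>fold_cable_cross\<close>).

Constant colourings are fixed, so an element of either kernel has exponent sum 0, and the powers of \<open>q\<close>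
disappear. The Alexander colouring has entries that are integer Laurent polynomials in the parameter. As both \<open>s\<close> and
\<open>s\<^sup>r\<close> are transcendental, it is trivial for one of them iff it is trivial for the other
(\<open>burau_trivialI\<close>, \<open>burau_trivialD\<close>). What remains is that the monomial part of such an element is trivial as well.
In this case the colouring with real parameter is trivial too; its value and its derivative at \<open>s = 1\<close> show that the
permutation is trivial and that every strand has undercrossing number 0 (\<open>burau_trivial_track\<close>). So both kernels are described by
the same condition (\<open>burau_eq_one_iff\<close>, \<open>burau_cabling_eq_one_iff\<close>).

For \<open>n \<ge> 5\<close> Bigelow's braid satisfies this condition by a computation with polynomials. It is nontrivial in every
\<open>B\<^sub>n\<close> because, after deletion of a strand, it changes a Fox colouring (\<open>bigelow_fox\<close>), which is
an invariant of braids (\<open>colour_pres_eq\<close>).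
\<close>

section \<open>Colourings of braid words\<close>

text \<open>A crossing acts on sequences of colours as in a rack: the letter \<open>\<sigma>\<^bsub>i\<^esub>\<close> turns the neighbouring colours
\<open>a, b\<close> into \<open>f a b, a\<close>, so the strand coloured \<open>a\<close> passes over unchanged. The operation \<open>g a\<close> is meant to
be the inverse of \<open>f a\<close>. The strands are numbered from 0, so \<open>\<sigma>\<^bsub>i\<^esub>\<close> concerns positions \<open>i - 1\<close> and \<open>i\<close>.\<close>

definition cross :: "('a \<Rightarrow> 'a \<Rightarrow> 'a) \<Rightarrow> ('a \<Rightarrow> 'a \<Rightarrow> 'a) \<Rightarrow> nat \<times> bool \<Rightarrow> (nat \<Rightarrow> 'a) \<Rightarrow> nat \<Rightarrow> 'a" where
  "cross f g l x = (case l of (i, e) \<Rightarrow>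
     if e then x(i - 1 := f (x (i - 1)) (x i), i := x (i - 1))
     else x(i - 1 := x i, i := g (x i) (x (i - 1))))"

definition colour :: "('a \<Rightarrow> 'a \<Rightarrow> 'a) \<Rightarrow> ('a \<Rightarrow> 'a \<Rightarrow> 'a) \<Rightarrow> nat gword \<Rightarrow> (nat \<Rightarrow> 'a) \<Rightarrow> nat \<Rightarrow> 'a" where
  "colour f g w = fold (cross f g) w"

lemma colour_simps [simp]:
  "colour f g [] x = x"
  "colour f g (l # w) x = colour f g w (cross f g l x)"
  "colour f g (u @ v) x = colour f g v (colour f g u x)"
  by (simp_all add: colour_def)

lemma cross_natural:
  assumes "\<And>a b. h (f a b) = f' (h a) (h b)" "\<And>a b. h (g a b) = g' (h a) (h b)"
  shows "cross f' g' l (\<lambda>k. h (x k)) = (\<lambda>k. h (cross f g l x k))"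
  by (auto simp: cross_def assms fun_eq_iff split: prod.splits)

lemma colour_natural:
  assumes "\<And>a b. h (f a b) = f' (h a) (h b)" "\<And>a b. h (g a b) = g' (h a) (h b)"
  shows "colour f' g' w (\<lambda>k. h (x k)) = (\<lambda>k. h (colour f g w x k))"
  by (induction w arbitrary: x) (simp_all add: cross_natural[of h f f' g g', OF assms])

lemma cross_fixed:
  "f (x (fst l - 1)) (x (fst l)) = x (fst l) \<Longrightarrow> g (x (fst l)) (x (fst l - 1)) = x (fst l - 1) \<Longrightarrow>
    x (fst l - 1) = x (fst l) \<Longrightarrow> cross f g l x = x"
  by (cases l) (auto simp: cross_def fun_eq_iff)

lemma colour_fixed:
  assumes "w \<in> gwords S"
    and "\<And>i. i \<in> S \<Longrightarrow> x (i - 1) = x i \<and> f (x i) (x i) = x i \<and> g (x i) (x i) = x i"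
  shows "colour f g w x = x"
  using assms(1)
proof (induction w)
  case (Cons l w)
  with assms(2)[of "fst l"] have "cross f g l x = x" by (intro cross_fixed) auto
  with Cons show ?case by simp
qed simp

definition gword_inv :: "'a gword \<Rightarrow> 'a gword" where
  "gword_inv w = rev (map (\<lambda>(s, e). (s, \<not> e)) w)"

lemma gword_inv_gwords [simp]: "gword_inv w \<in> gwords S \<longleftrightarrow> w \<in> gwords S"
  by (auto simp: gword_inv_def gwords_def in_lists_conv_set)

lemma gword_inv_inv [simp]: "gword_inv (gword_inv w) = w"
  by (induction w) (auto simp: gword_inv_def rev_map)

locale rack =
  fixes f g :: "'a \<Rightarrow> 'a \<Rightarrow> 'a"
  assumes fg [simp]: "f a (g a b) = b" and gf [simp]: "g a (f a b) = b"
begin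

lemma cross_inverse: "i > 0 \<Longrightarrow> cross f g (i, \<not> e) (cross f g (i, e) x) = x"
  by (auto simp: cross_def fun_eq_iff)

lemma colour_inverse: "w \<in> gwords {0<..} \<Longrightarrow> colour f g (gword_inv w) (colour f g w x) = x"
proof (induction w arbitrary: x)
  case (Cons l w)
  thus ?case by (cases l) (simp add: gword_inv_def cross_inverse)
qed (simp add: gword_inv_def)

lemma colour_inverse': "w \<in> gwords {0<..} \<Longrightarrow> colour f g w (colour f g (gword_inv w) x) = x"
  using colour_inverse[of "gword_inv w" x] by (simp add: gword_inv_inv)

text \<open>Self-distributivity is the third Reidemeister move, so colourings by a rack are invariants of the braid
and not only of the word. This is what detects that Bigelow's braid is nontrivial.\<close>

lemma colour_pres_eq:
  assumes distrib: "\<And>a b c. f a (f b c) = f (f a b) (f a c)"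
  shows "pres_eq {1..<m} (braid_rels m) u v \<Longrightarrow> colour f g u = colour f g v"
proof (induction rule: pres_eq.induct)
  case (cancel s e)
  have "cross f g (s, \<not> e) (cross f g (s, e) x) = x" for x
    using cancel by (intro cross_inverse) auto
  thus ?case by (simp add: fun_eq_iff)
next
  case (rel u v)
  from rel(1) consider
      i j where "u = pos_word [i, j]" "v = pos_word [j, i]" "i \<ge> 1" "i + 2 \<le> j"
    | i where "u = pos_word [i, i + 1, i]" "v = pos_word [i + 1, i, i + 1]" "i \<ge> 1"
    unfolding braid_rels_def by auto
  thus ?case
  proof cases
    case 1
    hence "i - 1 \<noteq> j - 1" "i \<noteq> j - 1" "i - 1 \<noteq> j" "i \<noteq> j" by auto
    with 1 show ?thesis by (auto simp: fun_eq_iff cross_def)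
  next
    case 2
    then obtain p where "i = Suc p" by (cases i) auto
    with 2 show ?thesis by (auto simp: fun_eq_iff cross_def distrib[symmetric])
  qed
qed (auto intro!: ext)

end

section \<open>Alexander colourings\<close>

text \<open>The Alexander quandle with parameter \<open>s\<close>. Its colourings are the action of the classical Burau matrices
(with \<open>s = q\<^sup>-\<^sup>2\<close>) on row vectors, before rescaling by \<open>q\<close>.\<close>

definition aff :: "'a :: field \<Rightarrow> 'a \<Rightarrow> 'a \<Rightarrow> 'a" where
  "aff s a b = (1 - s) * a + s * b"

definition affinv :: "'a :: field \<Rightarrow> 'a \<Rightarrow> 'a \<Rightarrow> 'a" where
  "affinv s a b = (b - (1 - s) * a) / s"

abbreviation burau_colour where "burau_colour s \<equiv> colour (aff s) (affinv s)"

text \<open>Here a strand is only multiplied by \<open>t\<close> each time it passes under another one; in the cabled representation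
this is how the deviations from the mean of a block behave.\<close>

abbreviation mono_colour :: "'a :: field \<Rightarrow> nat gword \<Rightarrow> (nat \<Rightarrow> 'a) \<Rightarrow> nat \<Rightarrow> 'a" where
  "mono_colour t \<equiv> colour (\<lambda>a b. t * b) (\<lambda>a b. b / t)"

lemma rack_aff: "s \<noteq> 0 \<Longrightarrow> rack (aff s) (affinv s)"
  by unfold_locales (simp_all add: aff_def affinv_def field_simps)

lemma rack_mono: "(t :: 'a :: field) \<noteq> 0 \<Longrightarrow> rack (\<lambda>a b. t * b) (\<lambda>a b. b / t)"
  by unfold_locales simp_all

section \<open>Universal integer polynomials\<close>

text \<open>The entries of a Burau matrix are integer Laurent polynomials in \<open>s\<close>. To stay among honest polynomials,
every negative letter multiplies the whole sequence by the variable.\<close>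

definition poly_cross :: "nat \<times> bool \<Rightarrow> (nat \<Rightarrow> int poly) \<Rightarrow> nat \<Rightarrow> int poly" where
  "poly_cross l x = (case l of (i, e) \<Rightarrow>
     if e then x(i - 1 := x (i - 1) + pCons 0 (x i - x (i - 1)), i := x (i - 1))
     else (\<lambda>k. pCons 0 (x k))(i - 1 := pCons 0 (x i), i := x (i - 1) - x i + pCons 0 (x i)))"

definition neg_letters :: "nat gword \<Rightarrow> nat" where
  "neg_letters w = length (filter (\<lambda>l. \<not> snd l) w)"

definition peval :: "'a :: field \<Rightarrow> int poly \<Rightarrow> 'a" where
  "peval s P = poly (map_poly of_int P) s"

lemma peval_simps [simp]:
  "peval s 0 = 0" "peval s 1 = 1" "peval s (P + Q) = peval s P + peval s Q"
  "peval s (P - Q) = peval s P - peval s Q" "peval s (P * Q) = peval s P * peval s Q"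
  "peval s (pCons c P) = of_int c + s * peval s P"
  "peval s (monom c k) = of_int c * s ^ k"
  by (simp_all add: peval_def of_int_poly_hom.hom_add of_int_poly_hom.hom_minus
      of_int_poly_hom.hom_mult of_int_hom.map_poly_pCons_hom map_poly_monom poly_monom)

lemma peval_poly_cross:
  assumes "s \<noteq> 0" "fst l > 0" "\<And>k. peval s (y k) = c * z k"
  shows "peval s (poly_cross l y b) = (if snd l then c else c * s) * cross (aff s) (affinv s) l z b"
  using assms by (cases l) (auto simp: poly_cross_def cross_def aff_def affinv_def field_simps)

lemma peval_fold_poly_cross:
  assumes "s \<noteq> 0" "w \<in> gwords {0<..}"
  shows "peval s (fold poly_cross w x b) = s ^ neg_letters w * burau_colour s w (\<lambda>k. peval s (x k)) b"
  using assms(2)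
proof (induction w arbitrary: b rule: rev_induct)
  case (snoc l w)
  have "peval s (fold poly_cross w x k) = s ^ neg_letters w * burau_colour s w (\<lambda>k. peval s (x k)) k" for k
    using snoc by simp
  from peval_poly_cross[OF assms(1) _ this, where l = l and b = b] snoc.prems show ?case
    by (simp add: neg_letters_def)
qed (simp add: neg_letters_def)

definition unit_seq :: "nat \<Rightarrow> nat \<Rightarrow> 'a :: zero_neq_one" where
  "unit_seq p k = (if k = p then 1 else 0)"

lemma peval_unit_seq: "peval s (unit_seq p k) = unit_seq p k"
  by (simp add: unit_seq_def)

text \<open>Triviality of the Alexander colouring for a generic parameter. Being a condition on integer polynomials, it
does not mention the parameter, and this is what links \<open>q\<close>, \<open>q\<^sup>r\<close> and real numbers.\<close>

definition burau_trivial :: "nat \<Rightarrow> nat gword \<Rightarrow> bool" where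
  "burau_trivial n w \<longleftrightarrow>
     (\<forall>p<n. \<forall>b<n. fold poly_cross w (unit_seq p) b = monom (if b = p then 1 else 0) (neg_letters w))"

lemma burau_trivialD:
  assumes "burau_trivial n w" "s \<noteq> 0" "w \<in> gwords {0<..}" "p < n" "b < n"
  shows "burau_colour s w (unit_seq p) b = unit_seq p b"
proof -
  have "s ^ neg_letters w * burau_colour s w (unit_seq p) b = peval s (monom (if b = p then 1 else 0) (neg_letters w))"
    using assms peval_fold_poly_cross[of s w "unit_seq p" b] by (simp add: burau_trivial_def peval_unit_seq)
  thus ?thesis using assms(2) by (auto simp: unit_seq_def split: if_splits)
qed

lemma burau_trivialI:
  assumes trans: "\<And>P. peval s P = 0 \<Longrightarrow> P = 0" and "w \<in> gwords {0<..}"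
    and "\<And>p b. p < n \<Longrightarrow> b < n \<Longrightarrow> burau_colour s w (unit_seq p) b = unit_seq p b"
  shows "burau_trivial n w"
  unfolding burau_trivial_def
proof (intro allI impI)
  fix p b assume pb: "p < n" "b < n"
  have "s \<noteq> 0" using trans[of "[:0, 1:]"] by auto
  hence "peval s (fold poly_cross w (unit_seq p) b - monom (if b = p then 1 else 0) (neg_letters w)) = 0"
    using assms(3)[OF pb] peval_fold_poly_cross[of s w "unit_seq p" b] assms(2)
    by (simp add: peval_unit_seq) (simp add: unit_seq_def)
  from trans[OF this] show "fold poly_cross w (unit_seq p) b = monom (if b = p then 1 else 0) (neg_letters w)"
    by simp
qed

section \<open>The monomial colouring and the derivative at 1\<close>

text \<open>The monomial colouring in logarithmic form: which strand arrives at a given position, and the signed number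
of its undercrossings.\<close>

definition track :: "nat gword \<Rightarrow> nat \<Rightarrow> nat \<times> int" where
  "track w = colour (\<lambda>a b. (fst b, snd b + 1)) (\<lambda>a b. (fst b, snd b - 1)) w (\<lambda>k. (k, 0))"

lemma mono_colour_track:
  assumes "t \<noteq> 0"
  shows "mono_colour t w y b = t powi snd (track w b) * y (fst (track w b))"
proof -
  have "mono_colour t w (\<lambda>k. (\<lambda>c. t powi snd c * y (fst c)) (k, 0)) =
      (\<lambda>k. (\<lambda>c. t powi snd c * y (fst c)) (track w k))"
    unfolding track_def using assms
    by (intro colour_natural) (simp_all add: power_int_add power_int_diff)
  thus ?thesis by (simp add: fun_eq_iff)
qed

lemma inj_track: "w \<in> gwords {0<..} \<Longrightarrow> inj (\<lambda>k. fst (track w k))"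
proof (induction w rule: rev_induct)
  case (snoc l w)
  obtain i e where l: "l = (i, e)" by (cases l)
  let ?\<pi> = "\<lambda>k. if k = i then i - 1 else if k = i - 1 then i else k"
  have "inj (\<lambda>k. fst (track w k))" using snoc by simp
  moreover have "inj ?\<pi>" by (auto simp: inj_def)
  moreover have "(\<lambda>k. fst (track (w @ [l]) k)) = (\<lambda>k. fst (track w k)) \<circ> ?\<pi>"
    using snoc.prems by (cases e) (auto simp: track_def l cross_def fun_eq_iff)
  ultimately show ?case by (simp only: inj_compose)
qed (simp add: track_def)

text \<open>At \<open>s = 1\<close> the Alexander quandle is trivial and only the permutation remains. To first order the entry
belonging to a strand \<open>p\<close> sees only the undercrossings of \<open>p\<close>: at such a crossing
\<open>(1 - s) a + s b\<close> has derivative \<open>b' + b - a\<close>, where \<open>b = 1\<close> and \<open>a = 0\<close> because a different strand passes over.\<close>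

lemma burau_colour_at_one:
  assumes "w \<in> gwords {0<..}"
  shows "burau_colour 1 w (unit_seq p) b = (unit_seq p (fst (track w b)) :: real) \<and>
    (\<lambda>s. burau_colour s w (unit_seq p) b) differentiable (at (1 :: real)) \<and>
    (fst (track w b) = p \<longrightarrow>
      ((\<lambda>s. burau_colour s w (unit_seq p) b) has_real_derivative of_int (snd (track w b))) (at 1))"
  using assms
proof (induction w arbitrary: b rule: rev_induct)
  case Nil
  show ?case by (auto simp: track_def)
next
  case (snoc l w)
  obtain i e where l: "l = (i, e)" by (cases l)
  have w: "w \<in> gwords {0<..}" and i: "i > 0" using snoc.prems l by auto
  have i': "i - Suc 0 \<noteq> i" using i by simp
  note IH = snoc.IH[OF w]
  let ?B = "\<lambda>s k. burau_colour s w (unit_seq p) k :: real"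
  have inj: "fst (track w j) = fst (track w k) \<longleftrightarrow> j = k" for j k
    using inj_track[OF w] by (auto simp: inj_def)
  have val: "?B 1 k = unit_seq p (fst (track w k))" for k using IH by blast
  have "\<forall>k. \<exists>D. ((\<lambda>s. ?B s k) has_real_derivative D) (at 1)"
    using IH by (simp add: real_differentiable_def)
  then obtain D where D: "((\<lambda>s. ?B s k) has_real_derivative D k) (at 1)" for k
    using choice[of "\<lambda>k D. ((\<lambda>s. ?B s k) has_real_derivative D) (at 1)"] by blast
  have Dk: "D k = of_int (snd (track w k))" if "fst (track w k) = p" for k
    using IH that D DERIV_unique by blast
  have tr: "track (w @ [(i, e')]) = cross (\<lambda>a b. (fst b, snd b + 1)) (\<lambda>a b. (fst b, snd b - 1)) (i, e') (track w)" for e'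
    by (simp add: track_def)
  consider (left) "b = i - 1" | (right) "b = i" | (other) "b \<noteq> i - 1" "b \<noteq> i" by blast
  thus ?case
  proof cases
    case left
    show ?thesis
    proof (cases e)
      case True
      have "((\<lambda>s. (1 - s) * ?B s (i - 1) + s * ?B s i)
        has_real_derivative D i + ?B 1 i - ?B 1 (i - 1)) (at 1)"
        by (rule derivative_eq_intros D HOL.refl)+ simp
      hence der: "((\<lambda>s. burau_colour s (w @ [l]) (unit_seq p) b)
        has_real_derivative D i + ?B 1 i - ?B 1 (i - 1)) (at 1)"
        using True i i' left by (simp add: l cross_def aff_def[of _ "burau_colour _ _ _ _"])
      have tr': "fst (track (w @ [l]) b) = fst (track w i)" "snd (track (w @ [l]) b) = snd (track w i) + 1"
        using True i left by (simp_all add: l tr cross_def)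
      have v: "burau_colour 1 (w @ [l]) (unit_seq p) b = ?B 1 i"
        using True i left by (simp add: l cross_def aff_def)
      have eq: "D i + ?B 1 i - ?B 1 (i - 1) = of_int (snd (track w i) + 1)"
        if "fst (track w i) = p"
        using that inj[of i "i - 1"] i' Dk[of i] by (simp add: val unit_seq_def)
      show ?thesis
      proof (intro conjI impI)
        show "burau_colour 1 (w @ [l]) (unit_seq p) b = (unit_seq p (fst (track (w @ [l]) b)) :: real)"
          unfolding tr' by (rule HOL.trans[OF v val])
        show "(\<lambda>s. burau_colour s (w @ [l]) (unit_seq p) b) differentiable (at (1 :: real))"
          using der unfolding real_differentiable_def by blast
        assume "fst (track (w @ [l]) b) = p"
        from der[unfolded eq[OF this[unfolded tr']]]
        show "((\<lambda>s. burau_colour s (w @ [l]) (unit_seq p) b) has_real_derivative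
            of_int (snd (track (w @ [l]) b))) (at 1)"
          unfolding tr' .
      qed
    next
      case False
      thus ?thesis using i i' left IH[of i] by (simp add: l tr cross_def)
    qed
  next
    case right
    show ?thesis
    proof (cases e)
      case True
      thus ?thesis using i i' right IH[of "i - 1"] by (simp add: l tr cross_def)
    next
      case False
      have "((\<lambda>s. (?B s (i - 1) - (1 - s) * ?B s i) / s)
        has_real_derivative D (i - 1) + ?B 1 i - ?B 1 (i - 1)) (at 1)"
        by (rule derivative_eq_intros D HOL.refl)+ auto
      hence der: "((\<lambda>s. burau_colour s (w @ [l]) (unit_seq p) b)
        has_real_derivative D (i - 1) + ?B 1 i - ?B 1 (i - 1)) (at 1)"
        using False i right by (simp add: l cross_def affinv_def[of _ "burau_colour _ _ _ _"])
      have tr': "fst (track (w @ [l]) b) = fst (track w (i - 1))"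
        "snd (track (w @ [l]) b) = snd (track w (i - 1)) - 1"
        using False i right by (simp_all add: l tr cross_def)
      have v: "burau_colour 1 (w @ [l]) (unit_seq p) b = ?B 1 (i - 1)"
        using False i right by (simp add: l cross_def affinv_def)
      have eq: "D (i - 1) + ?B 1 i - ?B 1 (i - 1) = of_int (snd (track w (i - 1)) - 1)"
        if "fst (track w (i - 1)) = p"
        using that inj[of i "i - 1"] i' Dk[of "i - 1"] by (simp add: val unit_seq_def)
      show ?thesis
      proof (intro conjI impI)
        show "burau_colour 1 (w @ [l]) (unit_seq p) b = (unit_seq p (fst (track (w @ [l]) b)) :: real)"
          unfolding tr' by (rule HOL.trans[OF v val])
        show "(\<lambda>s. burau_colour s (w @ [l]) (unit_seq p) b) differentiable (at (1 :: real))"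
          using der unfolding real_differentiable_def by blast
        assume "fst (track (w @ [l]) b) = p"
        from der[unfolded eq[OF this[unfolded tr']]]
        show "((\<lambda>s. burau_colour s (w @ [l]) (unit_seq p) b) has_real_derivative
            of_int (snd (track (w @ [l]) b))) (at 1)"
          unfolding tr' .
      qed
    qed
  next
    case other
    thus ?thesis using i IH[of b] by (cases e) (simp_all add: l tr cross_def)
  qed
qed

text \<open>A generically trivial Alexander colouring is constant near \<open>s = 1\<close>; comparing values and derivatives there
kills the permutation and the undercrossing numbers.\<close>

lemma burau_trivial_track:
  assumes "burau_trivial n w" "w \<in> gwords {0<..}" "b < n"
  shows "track w b = (b, 0)"
proof -
  let ?B = "\<lambda>s. burau_colour s w (unit_seq b) b :: real"
  have one: "?B s = 1" if "s \<noteq> 0" for s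
    using burau_trivialD[OF assms(1) that assms(2,3,3)] by (simp add: unit_seq_def)
  hence fst: "fst (track w b) = b"
    using burau_colour_at_one[OF assms(2), of b b] by (auto simp: unit_seq_def split: if_splits)
  hence "(?B has_real_derivative of_int (snd (track w b))) (at 1)"
    using burau_colour_at_one[OF assms(2), of b b] by blast
  moreover have "\<forall>\<^sub>F s in nhds (1 :: real). ?B s = 1"
    using t1_space_nhds[of 1 "0 :: real"] one by (auto elim: eventually_mono)
  hence "(?B has_real_derivative 0) (at 1)"
    by (subst DERIV_cong_ev[OF HOL.refl _ HOL.refl]) auto
  ultimately show ?thesis
    using fst DERIV_unique by (fastforce simp: prod_eq_iff)
qed

section \<open>Matrices acting on row vectors\<close>

text \<open>Transformations of infinite sequences stand for matrices acting on row vectors, so that the size of the matrix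
enters only through the bound on the index that is read off. Row vectors make matrix products
act in the order in which words are read.\<close>

definition acts_as :: "nat \<Rightarrow> 'a :: field mat \<Rightarrow> ((nat \<Rightarrow> 'a) \<Rightarrow> nat \<Rightarrow> 'a) \<Rightarrow> bool" where
  "acts_as m M T \<longleftrightarrow> (\<forall>x. \<forall>b<m. (\<Sum>a<m. x a * M $$ (a, b)) = T x b)"

lemma acts_asD: "acts_as m M T \<Longrightarrow> b < m \<Longrightarrow> (\<Sum>a<m. x a * M $$ (a, b)) = T x b"
  by (simp add: acts_as_def)

lemma index_mult_mat_sum:
  assumes "M \<in> carrier_mat m m" "N \<in> carrier_mat m m" "a < m" "b < m"
  shows "(M * N) $$ (a, b) = (\<Sum>k<m. M $$ (a, k) * N $$ (k, b))"
  using assms by (simp add: scalar_prod_def lessThan_atLeast0)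

lemma row_mult:
  assumes "M \<in> carrier_mat m m" "N \<in> carrier_mat m m" "b < m"
  shows "(\<Sum>a<m. x a * (M * N) $$ (a, b)) = (\<Sum>k<m. (\<Sum>a<m. x a * M $$ (a, k)) * N $$ (k, b))"
proof -
  have "(\<Sum>a<m. x a * (M * N) $$ (a, b)) = (\<Sum>a<m. \<Sum>k<m. x a * M $$ (a, k) * N $$ (k, b))"
    using assms by (simp add: index_mult_mat_sum sum_distrib_left mult.assoc del: index_mult_mat(1))
  also have "\<dots> = (\<Sum>k<m. \<Sum>a<m. x a * M $$ (a, k) * N $$ (k, b))"
    by (rule sum.swap)
  finally show ?thesis by (simp add: sum_distrib_right)
qed

lemma row_one: "b < m \<Longrightarrow> (\<Sum>a<m. x a * (1\<^sub>m m :: 'a :: field mat) $$ (a, b)) = x b"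
proof -
  assume "b < m"
  hence "(\<Sum>a<m. x a * (1\<^sub>m m :: 'a mat) $$ (a, b)) = (\<Sum>a<m. if a = b then x a else 0)"
    by (intro sum.cong) auto
  with \<open>b < m\<close> show ?thesis by simp
qed

lemma acts_as_mult:
  assumes "M \<in> carrier_mat m m" "N \<in> carrier_mat m m" "acts_as m M T" "acts_as m N U"
  shows "acts_as m (M * N) (\<lambda>x. U (T x))"
  unfolding acts_as_def
proof (intro allI impI)
  fix x b assume b: "b < m"
  have "(\<Sum>a<m. x a * (M * N) $$ (a, b)) = (\<Sum>k<m. T x k * N $$ (k, b))"
    using assms b by (simp add: row_mult acts_asD[OF assms(3)] del: index_mult_mat(1))
  thus "(\<Sum>a<m. x a * (M * N) $$ (a, b)) = U (T x) b"
    using acts_asD[OF assms(4) b] by simp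
qed

lemma acts_as_inverse:
  assumes "M \<in> carrier_mat m m" "N \<in> carrier_mat m m" "M * N = 1\<^sub>m m" "acts_as m M T"
    and "\<And>x b. b < m \<Longrightarrow> T (U x) b = x b"
  shows "acts_as m N U"
  unfolding acts_as_def
proof (intro allI impI)
  fix x b assume b: "b < m"
  have "(\<Sum>k<m. x k * N $$ (k, b)) = (\<Sum>k<m. T (U x) k * N $$ (k, b))"
    using assms(5) by simp
  also have "\<dots> = (\<Sum>a<m. U x a * (M * N) $$ (a, b))"
    using assms(1,2) b by (simp add: row_mult acts_asD[OF assms(4)] del: index_mult_mat(1))
  also have "\<dots> = U x b" using b by (simp add: assms(3) row_one del: index_one_mat(1))
  finally show "(\<Sum>k<m. x k * N $$ (k, b)) = U x b" .
qed

lemma GL_carrierD: "M \<in> carrier (GL m) \<Longrightarrow> M \<in> carrier_mat m m"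
  by (simp add: GL_simps Units_def ring_mat_simps)

lemma acts_as_gword_eval:
  fixes f :: "'s \<Rightarrow> 'a :: field mat"
  assumes f: "f \<in> S \<rightarrow> carrier (GL m)"
    and T: "\<And>s. s \<in> S \<Longrightarrow> acts_as m (f s) (T (s, True))"
    and inv: "\<And>s x b. s \<in> S \<Longrightarrow> b < m \<Longrightarrow> T (s, True) (T (s, False) x) b = x b"
    and "w \<in> gwords S"
  shows "acts_as m (gword_eval (GL m) f w) (fold T w)"
  using assms(4)
proof (induction w)
  case Nil
  show ?case by (simp add: GL_simps acts_as_def row_one del: index_one_mat(1))
next
  case (Cons l w)
  interpret GL: group "GL m :: 'a mat monoid" by (rule group_GL)
  obtain s e where l: "l = (s, e)" by (cases l)
  have s: "s \<in> S" and w: "w \<in> gwords S" using Cons.prems l by auto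
  have fs: "f s \<in> carrier (GL m)" using f s by auto
  have "f s * inv\<^bsub>GL m\<^esub> f s = 1\<^sub>m m" using GL.r_inv[OF fs] by (simp add: GL_simps)
  from acts_as_inverse[OF GL_carrierD[OF fs] GL_carrierD[OF GL.inv_closed[OF fs]] this T[OF s] inv[OF s]]
  have "acts_as m (inv\<^bsub>GL m\<^esub> f s) (T (s, False))" by blast
  moreover have "gword_eval (GL m) f w \<in> carrier_mat m m"
    by (intro GL_carrierD gword_eval_closed[OF group_GL f w])
  ultimately have "acts_as m (gword_eval (GL m) f (l # w)) (\<lambda>x. fold T w (T l x))"
    using acts_as_mult[OF GL_carrierD[OF fs] _ T[OF s] Cons.IH[OF w]]
      acts_as_mult[OF GL_carrierD[OF GL.inv_closed[OF fs]] _ _ Cons.IH[OF w], of "T (s, False)"]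
    by (simp add: l GL_simps)
  thus ?case by (simp add: comp_def)
qed

lemma acts_as_eq_one_iff:
  assumes "M \<in> carrier_mat m m" "acts_as m M T"
  shows "M = 1\<^sub>m m \<longleftrightarrow> (\<forall>x. \<forall>b<m. T x b = x b)"
proof
  assume "M = 1\<^sub>m m"
  thus "\<forall>x. \<forall>b<m. T x b = x b" using assms(2) by (simp add: acts_as_def row_one del: index_one_mat(1))
next
  assume id: "\<forall>x. \<forall>b<m. T x b = x b"
  show "M = 1\<^sub>m m"
  proof (rule eq_matI)
    fix a b assume "a < dim_row (1\<^sub>m m :: 'a mat)" "b < dim_col (1\<^sub>m m :: 'a mat)"
    hence ab: "a < m" "b < m" by auto
    have "M $$ (a, b) = (\<Sum>k<m. if k = a then M $$ (k, b) else 0)" using ab by simp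
    also have "\<dots> = (\<Sum>k<m. unit_seq a k * M $$ (k, b))"
      by (intro sum.cong) (auto simp: unit_seq_def)
    also have "\<dots> = unit_seq a b" using id acts_asD[OF assms(2) ab(2)] ab by simp
    finally show "M $$ (a, b) = 1\<^sub>m m $$ (a, b)" using ab by (simp add: unit_seq_def)
  qed (use assms in auto)
qed

definition exponent_sum :: "nat gword \<Rightarrow> int" where
  "exponent_sum w = (\<Sum>(i, e)\<leftarrow>w. if e then 1 else - 1)"

lemma exponent_sum_simps [simp]:
  "exponent_sum [] = 0" "exponent_sum ((i, e) # w) = (if e then 1 else - 1) + exponent_sum w"
  "exponent_sum (u @ v) = exponent_sum u + exponent_sum v"
  by (simp_all add: exponent_sum_def)

text \<open>A scalar attached to each letter only contributes a power of it given by the exponent sum.\<close>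

lemma fold_scaled:
  fixes c :: "'a :: field"
  assumes "c \<noteq> 0"
    and "\<And>l k x. C l (\<lambda>b. k * x b) = (\<lambda>b. k * C l x b)"
  shows "fold (\<lambda>l x b. c powi (if snd l then 1 else - 1) * C l x b) w x = (\<lambda>b. c powi exponent_sum w * fold C w x b)"
proof (induction w rule: rev_induct)
  case (snoc l w)
  obtain i e where l: "l = (i, e)" by (cases l)
  have "fold (\<lambda>l x b. c powi (if snd l then 1 else - 1) * C l x b) (w @ [l]) x =
      (\<lambda>b. c powi (if e then 1 else - 1) * C l (\<lambda>b. c powi exponent_sum w * fold C w x b) b)"
    by (simp add: snoc l)
  also have "\<dots> = (\<lambda>b. c powi exponent_sum (w @ [l]) * fold C (w @ [l]) x b)"
    unfolding assms(2) using assms(1) by (cases e) (simp_all add: l power_int_add power_int_diff divide_inverse fun_eq_iff)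
  finally show ?case .
qed simp

section \<open>The Burau representation as a colouring\<close>

lemma cross_aff_scale: "cross (aff s) (affinv s) l (\<lambda>b. k * x b) = (\<lambda>b. k * cross (aff s) (affinv s) l x b)"
  by (intro cross_natural) (simp_all add: aff_def affinv_def algebra_simps)

text \<open>Since \<open>q I\<close> can be factored out of \<open>R(\<sigma>\<^bsub>i\<^esub>)\<close>, the remaining block has first row \<open>1 - q\<^sup>-\<^sup>2, 1\<close> and second row
\<open>q\<^sup>-\<^sup>2, 0\<close>; this is the Alexander quandle with the following parameter.\<close>

definition burau_param :: "'k :: field poly fract" where
  "burau_param = inverse (qvar ^ 2)"

lemma burau_param_nonzero: "burau_param \<noteq> 0"
  using qvar_nonzero by (simp add: burau_param_def)

lemma acts_as_burau_gen:
  assumes "i \<in> {1..<m}"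
  shows "acts_as m (burau_gen m i) (\<lambda>x b. qvar powi 1 * cross (aff burau_param) (affinv burau_param) (i, True) x b)"
  unfolding acts_as_def
proof (intro allI impI)
  fix x :: "nat \<Rightarrow> 'a poly fract" and b assume b: "b < m"
  let ?q = "qvar :: 'a poly fract"
  have i: "i - 1 < m" "i < m" "i - 1 \<noteq> i" using assms by auto
  have "(\<Sum>a<m. x a * burau_gen m i $$ (a, b)) =
    (\<Sum>a<m. (if a = i - 1 then x a * ((if b = i - 1 then ?q - inverse ?q else 0) + (if b = i then ?q else 0)) else 0)
      + (if a = i then x a * (if b = i - 1 then inverse ?q else 0) else 0)
      + (if a = b then (if b = i - 1 \<or> b = i then 0 else x a * ?q) else 0))"
    using b i by (intro sum.cong) (auto simp: burau_gen_eq[OF assms] local_mat_def)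
  also have "\<dots> = x (i - 1) * ((if b = i - 1 then ?q - inverse ?q else 0) + (if b = i then ?q else 0))
      + x i * (if b = i - 1 then inverse ?q else 0) + (if b = i - 1 \<or> b = i then 0 else x b * ?q)"
    unfolding sum.distrib using b i by simp
  also have "\<dots> = ?q powi 1 * cross (aff burau_param) (affinv burau_param) (i, True) x b"
    using i qvar_nonzero[where 'k = 'a]
    by (auto simp: cross_def aff_def burau_param_def field_simps power2_eq_square)
  finally show "(\<Sum>a<m. x a * burau_gen m i $$ (a, b)) = ?q powi 1 * cross (aff burau_param) (affinv burau_param) (i, True) x b" .
qed

lemma acts_as_burau:
  assumes "w \<in> gwords {1..<m}"
  shows "acts_as m (gword_eval (GL m) (burau_gen m :: nat \<Rightarrow> 'k :: field poly fract mat) w)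
    (\<lambda>x b. qvar powi exponent_sum w * burau_colour burau_param w x b)"
proof -
  let ?T = "\<lambda>l x b. (qvar :: 'k poly fract) powi (if snd l then 1 else - 1) * cross (aff burau_param) (affinv burau_param) l x b"
  have "acts_as m (gword_eval (GL m) (burau_gen m) w) (fold ?T w)"
  proof (rule acts_as_gword_eval[OF _ _ _ assms])
    fix s and x :: "nat \<Rightarrow> 'k poly fract" and b assume "s \<in> {1..<m}"
    hence "cross (aff burau_param) (affinv burau_param) (s, True) (cross (aff burau_param) (affinv burau_param) (s, False) x) = x"
      using rack.cross_inverse[OF rack_aff[OF burau_param_nonzero], of s False] by simp
    thus "?T (s, True) (?T (s, False) x) b = x b"
      using qvar_nonzero[where 'k = 'k] by (simp add: cross_aff_scale)
  next
    show "burau_gen m \<in> {1..<m} \<rightarrow> carrier (GL m :: 'k poly fract mat monoid)"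
      by (intro funcsetI burau_gen_closed)
  qed (use acts_as_burau_gen[where 'a = 'k] in simp)
  thus ?thesis
    using fold_scaled[OF qvar_nonzero[where 'k = 'k], of "cross (aff burau_param) (affinv burau_param)", OF cross_aff_scale]
    by (simp add: acts_as_def colour_def)
qed

section \<open>Cabled crossings\<close>

text \<open>The strand at position \<open>x\<close> passes under the \<open>k\<close> strands to its left, nearest first, and these move one place to
the right.\<close>

lemma colour_descending:
  "k \<le> x \<Longrightarrow> colour f g (pos_word (descending x k)) y =
    (\<lambda>i. if i = x - k then foldr (\<lambda>j. f (y j)) [x - k..<x] (y x)
         else if x - k < i \<and> i \<le> x then y (i - 1) else y i)"
proof (induction k)
  case 0
  show ?case by (auto simp: descending_def fun_eq_iff)
next
  case (Suc k)
  have "pos_word (descending x (Suc k)) = pos_word (descending x k) @ [(x - k, True)]"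
    by (simp add: descending_def)
  moreover have "[x - Suc k..<x] = (x - Suc k) # [x - k..<x]"
    using Suc.prems by (simp add: upt_conv_Cons Suc_diff_Suc)
  moreover have "x - Suc k < x - k" "x - k - 1 = x - Suc k" using Suc.prems by auto
  ultimately show ?case using Suc by (auto simp: cross_def fun_eq_iff)
qed

text \<open>Repeating this, \<open>m\<close> strands pass one after the other under the same \<open>r\<close> strands, whose colours never change. Hence
each of them undergoes the same composite operation.\<close>

lemma colour_block:
  "colour f g (pos_word (concat (map (\<lambda>a. descending (d + r + a) r) [0..<m]))) y =
    (\<lambda>i. if d \<le> i \<and> i < d + m then foldr (\<lambda>j. f (y j)) [d..<d + r] (y (i + r))
         else if d + m \<le> i \<and> i < d + r + m then y (i - m) else y i)"
proof (induction m)
  case 0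
  show ?case by (auto simp: fun_eq_iff)
next
  case (Suc m)
  define F where "F b = foldr (\<lambda>j. f (y j)) [d..<d + r] b" for b
  define z where "z = (\<lambda>i. if d \<le> i \<and> i < d + m then F (y (i + r))
         else if d + m \<le> i \<and> i < d + r + m then y (i - m) else y i)"
  have sub: "d + r + m - r = d + m" by simp
  have "[d + m..<d + r + m] = map (\<lambda>j. j + m) [d..<d + r]"
    by (intro nth_equalityI) auto
  hence shift: "foldr (\<lambda>j. f (z j)) [d + m..<d + r + m] = F"
    by (auto simp: F_def z_def foldr_map comp_def fun_eq_iff intro!: foldr_cong)
  have "colour f g (pos_word (concat (map (\<lambda>a. descending (d + r + a) r) [0..<Suc m]))) y =
      colour f g (pos_word (descending (d + r + m) r)) z"
    using Suc.IH unfolding z_def F_def by simp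
  also have "\<dots> = (\<lambda>i. if i = d + m then F (z (d + r + m))
         else if d + m < i \<and> i \<le> d + r + m then z (i - 1) else z i)"
    using colour_descending[of r "d + r + m" f g z] unfolding sub shift by simp
  also have "\<dots> = (\<lambda>i. if d \<le> i \<and> i < d + Suc m then F (y (i + r))
         else if d + Suc m \<le> i \<and> i < d + r + Suc m then y (i - Suc m) else y i)"
  proof
    fix i
    consider "i < d" | "d \<le> i" "i < d + m" | "i = d + m" | "d + m < i" "i \<le> d + r + m" | "i > d + r + m"
      by linarith
    thus "(if i = d + m then F (z (d + r + m))
         else if d + m < i \<and> i \<le> d + r + m then z (i - 1) else z i) =
      (if d \<le> i \<and> i < d + Suc m then F (y (i + r))
         else if d + Suc m \<le> i \<and> i < d + r + Suc m then y (i - Suc m) else y i)"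
      by cases (auto simp: z_def add.commute add.left_commute)
  qed
  finally show ?case by (simp only: F_def)
qed

text \<open>The composite of the affine maps \<open>aff s a\<close> over a block is again affine, with ratio \<open>s\<^sup>r\<close>. Its fixed point,
a weighted mean of the block, is \<open>block_mean\<close> below.\<close>

lemma foldr_aff:
  "foldr (\<lambda>j. aff s (y j)) [a..<a + r] b = s ^ r * b + (\<Sum>k<r. (1 - s) * s ^ k * y (a + k))"
  by (induction r arbitrary: b) (simp_all add: aff_def algebra_simps)

definition block_mean :: "'a :: field \<Rightarrow> nat \<Rightarrow> (nat \<Rightarrow> 'a) \<Rightarrow> nat \<Rightarrow> 'a" where
  "block_mean s r x i = (\<Sum>k<r. (1 - s) * s ^ k * x (r * i + k)) / (1 - s ^ r)"

definition block_dev :: "'a :: field \<Rightarrow> nat \<Rightarrow> nat \<Rightarrow> (nat \<Rightarrow> 'a) \<Rightarrow> nat \<Rightarrow> 'a" where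
  "block_dev s r k x i = x (r * i + k) - block_mean s r x i"

text \<open>The weights of the mean sum to 1 by the geometric series.\<close>

lemma block_mean_affine:
  assumes "s ^ r \<noteq> 1" "\<And>k. k < r \<Longrightarrow> y (r * i + k) = c * x (r * j + k) + d"
  shows "block_mean s r y i = c * block_mean s r x j + d"
proof -
  have geo: "(\<Sum>k<r. (1 - s) * s ^ k) = 1 - s ^ r"
    using one_diff_power_eq[of s r] by (simp add: sum_distrib_left)
  have "(\<Sum>k<r. (1 - s) * s ^ k * y (r * i + k)) =
      (\<Sum>k<r. c * ((1 - s) * s ^ k * x (r * j + k)) + d * ((1 - s) * s ^ k))"
    using assms(2) by (intro sum.cong) (simp_all add: algebra_simps)
  also have "\<dots> = c * (\<Sum>k<r. (1 - s) * s ^ k * x (r * j + k)) + d * (\<Sum>k<r. (1 - s) * s ^ k)"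
    by (simp only: sum.distrib sum_distrib_left)
  finally show ?thesis
    unfolding block_mean_def geo using assms(1) by (simp add: add_divide_distrib)
qed

text \<open>The summands with factor 1 and constant 0 put all three cases in the affine form \<open>c x + d\<close>, to which
\<open>block_mean_affine\<close> applies.\<close>

lemma burau_colour_cable_word:
  assumes "i > 0" "k < r" "s ^ r \<noteq> 1"
  shows "burau_colour s (pos_word (cable_word r i)) x (r * j + k) =
    (if j = i - 1 then s ^ r * x (r * i + k) + (1 - s ^ r) * block_mean s r x (i - 1)
     else if j = i then 1 * x (r * (i - 1) + k) + 0 else 1 * x (r * j + k) + 0)"
proof -
  obtain i' where i: "i = Suc i'" using assms(1) by (cases i) auto
  have F: "foldr (\<lambda>j. aff s (x j)) [r * i'..<r * i' + r] b = s ^ r * b + (1 - s ^ r) * block_mean s r x i'" for b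
    using foldr_aff[of s x "r * i'" r b] assms(3) by (simp add: block_mean_def)
  have col: "burau_colour s (pos_word (cable_word r i)) x =
    (\<lambda>c. if r * i' \<le> c \<and> c < r * i' + r then s ^ r * x (c + r) + (1 - s ^ r) * block_mean s r x i'
         else if r * i' + r \<le> c \<and> c < r * i' + r + r then x (c - r) else x c)"
    using colour_block[of "aff s" "affinv s" "r * i'" r r x, unfolded F]
    by (simp add: cable_word_def i add.commute[of r])
  consider "j < i'" | "j = i'" | "j = i" | "j \<ge> i + 1" using i by linarith
  thus ?thesis
  proof cases
    case 1
    hence "r * Suc j \<le> r * i'" by (intro mult_le_mono2) auto
    thus ?thesis unfolding col using 1 assms(2) by (simp add: i)
  next
    case 4
    hence "r * (i + 1) \<le> r * j" by (intro mult_le_mono2) auto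
    thus ?thesis unfolding col using 4 assms(2) by (simp add: i)
  qed (unfold col, use assms(2) in \<open>simp_all add: i algebra_simps\<close>)
qed

definition cable_cross :: "'a :: field \<Rightarrow> nat \<Rightarrow> nat \<times> bool \<Rightarrow> (nat \<Rightarrow> 'a) \<Rightarrow> nat \<Rightarrow> 'a" where
  "cable_cross s r l = burau_colour s
     (if snd l then pos_word (cable_word r (fst l)) else gword_inv (pos_word (cable_word r (fst l))))"

lemma cable_word_gwords: "i > 0 \<Longrightarrow> pos_word (cable_word r i) \<in> gwords {0<..}"
  using cable_sub[of i "Suc i" r] by fastforce

lemma cable_cross_inverse:
  assumes "i > 0" "s \<noteq> 0"
  shows "cable_cross s r (i, True) (cable_cross s r (i, False) x) = x"
  using rack.colour_inverse'[OF rack_aff[OF assms(2)] cable_word_gwords[OF assms(1)]]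
  by (simp add: cable_cross_def)

text \<open>Under a cabled crossing the means of the blocks are coloured by the Alexander quandle with parameter \<open>s\<^sup>r\<close>. Taking
the mean commutes with the affine map, whose fixed point is the mean of the overcrossing block, so that the deviations
are merely multiplied by \<open>s\<^sup>r\<close>.\<close>

lemma block_cross_pos:
  assumes "i > 0" "s ^ r \<noteq> 1"
  shows "block_mean s r (cable_cross s r (i, True) x) =
      cross (aff (s ^ r)) (affinv (s ^ r)) (i, True) (block_mean s r x)"
    and "k < r \<Longrightarrow> block_dev s r k (cable_cross s r (i, True) x) =
      cross (\<lambda>a b. s ^ r * b) (\<lambda>a b. b / s ^ r) (i, True) (block_dev s r k x)"
proof -
  note C = burau_colour_cable_word[OF assms(1) _ assms(2)]
  have i: "i - Suc 0 \<noteq> i" using assms(1) by simp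
  have mean: "block_mean s r (cable_cross s r (i, True) x) j =
      cross (aff (s ^ r)) (affinv (s ^ r)) (i, True) (block_mean s r x) j" for j
  proof -
    consider "j = i - 1" | "j = i" | "j \<noteq> i - 1" "j \<noteq> i" by blast
    thus ?thesis
    proof cases
      case 1
      thus ?thesis
        using assms i block_mean_affine[OF assms(2), of "cable_cross s r (i, True) x" j "s ^ r" x i
          "(1 - s ^ r) * block_mean s r x (i - 1)"]
        by (simp add: cable_cross_def C cross_def aff_def)
    next
      case 2
      thus ?thesis
        using assms i i[symmetric] block_mean_affine[OF assms(2), of "cable_cross s r (i, True) x" j 1 x "i - 1" 0]
        by (simp add: cable_cross_def C cross_def)
    next
      case 3
      thus ?thesis
        using assms i i[symmetric] block_mean_affine[OF assms(2), of "cable_cross s r (i, True) x" j 1 x j 0]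
        by (simp add: cable_cross_def C cross_def)
    qed
  qed
  thus "block_mean s r (cable_cross s r (i, True) x) =
      cross (aff (s ^ r)) (affinv (s ^ r)) (i, True) (block_mean s r x)" by blast
  assume "k < r"
  thus "block_dev s r k (cable_cross s r (i, True) x) =
      cross (\<lambda>a b. s ^ r * b) (\<lambda>a b. b / s ^ r) (i, True) (block_dev s r k x)"
    using i i[symmetric] unfolding block_dev_def mean
    by (auto simp: fun_eq_iff cable_cross_def C cross_def aff_def right_diff_distrib left_diff_distrib)
qed

text \<open>Negative letters follow from the positive ones, because both sides of each identity are inverted.\<close>

lemma block_cross:
  assumes "fst l > 0" "s ^ r \<noteq> 1" "s \<noteq> 0"
  shows "block_mean s r (cable_cross s r l x) = cross (aff (s ^ r)) (affinv (s ^ r)) l (block_mean s r x)"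
    and "k < r \<Longrightarrow> block_dev s r k (cable_cross s r l x) =
      cross (\<lambda>a b. s ^ r * b) (\<lambda>a b. b / s ^ r) l (block_dev s r k x)"
proof -
  obtain i e where l: "l = (i, e)" by (cases l)
  have i: "i > 0" and t: "s ^ r \<noteq> 0" using assms l by auto
  note inv = cable_cross_inverse[OF i assms(3)]
  have "block_mean s r (cable_cross s r (i, False) x) = cross (aff (s ^ r)) (affinv (s ^ r)) (i, False) (block_mean s r x)"
    using block_cross_pos(1)[OF i assms(2), of "cable_cross s r (i, False) x"]
      rack.cross_inverse[OF rack_aff[OF t], of i True] i by (simp add: inv)
  thus "block_mean s r (cable_cross s r l x) = cross (aff (s ^ r)) (affinv (s ^ r)) l (block_mean s r x)"
    using block_cross_pos(1)[OF i assms(2)] by (cases e) (simp_all add: l)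
  assume k: "k < r"
  have "block_dev s r k (cable_cross s r (i, False) x) = cross (\<lambda>a b. s ^ r * b) (\<lambda>a b. b / s ^ r) (i, False) (block_dev s r k x)"
    using block_cross_pos(2)[OF i assms(2) k, of "cable_cross s r (i, False) x"]
      rack.cross_inverse[OF rack_mono[OF t], of i True "block_dev s r k (cable_cross s r (i, False) x)"] i by (simp add: inv)
  thus "block_dev s r k (cable_cross s r l x) = cross (\<lambda>a b. s ^ r * b) (\<lambda>a b. b / s ^ r) l (block_dev s r k x)"
    using block_cross_pos(2)[OF i assms(2) k] by (cases e) (simp_all add: l)
qed

text \<open>The cabled Burau representation splits into the Burau representation at \<open>s\<^sup>r\<close>, carried by the means, and
monomial representations, carried by the deviations.\<close>

lemma fold_cable_cross:
  assumes "w \<in> gwords {0<..}" "s ^ r \<noteq> 1" "s \<noteq> 0" "k < r"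
  shows "fold (cable_cross s r) w x (r * i + k) =
    burau_colour (s ^ r) w (block_mean s r x) i + mono_colour (s ^ r) w (block_dev s r k x) i"
proof -
  have "block_mean s r (fold (cable_cross s r) w x) = burau_colour (s ^ r) w (block_mean s r x) \<and>
      block_dev s r k (fold (cable_cross s r) w x) = mono_colour (s ^ r) w (block_dev s r k x)"
    using assms(1)
  proof (induction w arbitrary: x)
    case (Cons l w)
    thus ?case using block_cross[OF _ assms(2,3), of l] assms(4) by simp
  qed simp
  thus ?thesis by (metis add.commute block_dev_def diff_add_cancel)
qed

section \<open>Transcendence of the powers of q\<close>

text \<open>Substituting the inverse reverses the coefficients, which reduces the claim to polynomials in \<open>q\<^sup>d\<close>. There it says
that composing with a nonconstant polynomial is injective.\<close>

lemma peval_qvar_inverse_eq_0: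
  assumes "peval (inverse (qvar ^ d) :: 'k :: field_char_0 poly fract) P = 0" "d > 0"
  shows "P = 0"
proof -
  have hom: "Fract (a + b) 1 = Fract a 1 + Fract b 1" "Fract (a * b) 1 = Fract a 1 * Fract b 1"
    for a b :: "'k poly" by simp_all
  have q: "(qvar :: 'k poly fract) ^ d = Fract (monom 1 d) 1"
    by (induction d) (simp_all add: qvar_def One_fract_def monom_Suc flip: monom_0)
  have int: "(of_int c :: 'k poly fract) = Fract [:of_int c:] 1" for c
    by (cases c rule: int_cases2) (simp_all add: of_nat_fract of_nat_poly)
  let ?P = "map_poly of_int P :: 'k poly fract poly"
  have "of_int c \<noteq> (0 :: 'k poly fract)" if "c \<noteq> 0" for c
    using that by (simp add: int Zero_fract_def eq_fract)
  hence deg: "degree ?P = degree P" by (rule Polynomial.degree_map_poly)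
  have "poly (reflect_poly ?P) (qvar ^ d) = 0"
    using assms(1) qvar_nonzero[where 'k = 'k] by (simp add: poly_reflect_poly_nz peval_def)
  moreover have "reflect_poly ?P = map_poly of_int (reflect_poly P)"
    by (intro poly_eqI) (simp add: coeff_reflect_poly coeff_map_poly deg)
  moreover have "peval (qvar ^ d :: 'k poly fract) R = Fract (pcompose (map_poly of_int R) (monom 1 d)) 1" for R
  proof (induction R)
    case 0
    show ?case by (simp add: Zero_fract_def)
  next
    case (pCons a R)
    thus ?case
      by (simp only: peval_simps int q of_int_hom.map_poly_pCons_hom pcompose_pCons hom)
  qed
  ultimately have "Fract (pcompose (map_poly of_int (reflect_poly P)) (monom (1 :: 'k) d)) 1 = 0"
    by (simp add: peval_def)
  hence "pcompose (map_poly of_int (reflect_poly P)) (monom (1 :: 'k) d) = 0"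
    by (simp add: Zero_fract_def eq_fract)
  hence "map_poly of_int (reflect_poly P) = (0 :: 'k poly)"
    using assms(2) by (subst (asm) pcompose_eq_0_iff) (simp_all add: degree_monom_eq)
  thus "P = 0" by simp
qed

lemma qvar_powi_eq_1:
  assumes "(qvar :: 'k :: field_char_0 poly fract) powi k = 1"
  shows "k = 0"
proof (rule ccontr)
  assume "k \<noteq> 0"
  have "(qvar :: 'k poly fract) ^ nat \<bar>k\<bar> = 1"
    using assms by (cases "k \<ge> 0") (auto simp: power_int_def power_inverse)
  hence "peval (inverse (qvar ^ nat \<bar>k\<bar>) :: 'k poly fract) [:- 1, 1:] = 0"
    by simp
  from peval_qvar_inverse_eq_0[OF this] \<open>k \<noteq> 0\<close> show False by simp
qed

section \<open>The two kernels\<close>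

lemma cross_aff_sum:
  assumes "\<And>b. b < n \<Longrightarrow> z b = (\<Sum>p<n. y p * Z p b)" "fst l < n" "b < n"
  shows "cross (aff s) (affinv s) l z b = (\<Sum>p<n. y p * cross (aff s) (affinv s) l (Z p) b)"
proof -
  obtain i e where l: "l = (i, e)" by (cases l)
  have "i - 1 < n" "i < n" using assms l by auto
  thus ?thesis
    using assms(3) by (cases e) (auto simp: l cross_def aff_def affinv_def assms(1) sum_distrib_left
        sum_distrib_right sum.distrib sum_subtractf divide_inverse algebra_simps)
qed

text \<open>Colours at positions beyond \<open>n\<close> never enter, so finitely many unit sequences determine the action.\<close>

lemma burau_colour_expand:
  assumes "w \<in> gwords {1..<n}" "b < n"
  shows "burau_colour s w y b = (\<Sum>p<n. y p * burau_colour s w (unit_seq p) b)"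
  using assms
proof (induction w arbitrary: b rule: rev_induct)
  case Nil
  have "(\<Sum>p<n. y p * unit_seq p b) = (\<Sum>p<n. if p = b then y p else 0)"
    by (intro sum.cong) (auto simp: unit_seq_def)
  thus ?case using Nil by simp
next
  case (snoc l w)
  have "fst l < n" "w \<in> gwords {1..<n}" using snoc.prems by auto
  with snoc show ?case
    by (simp add: cross_aff_sum[where Z = "\<lambda>p. burau_colour s w (unit_seq p)"])
qed

lemma burau_pres_class:
  assumes "w \<in> gwords {1..<m}"
  shows "burau m (pres_class {1..<m} (braid_rels m) w) = gword_eval (GL m) (burau_gen m) w"
  unfolding burau_def
  by (intro presented_lift_class group_GL burau_respects funcsetI burau_gen_closed assms)

text \<open>Constant sequences are fixed by Alexander colourings, since the quandle is idempotent. Applied to such a sequence,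
triviality of \<open>q\<^sup>e\<close> times the colouring gives \<open>q\<^sup>e = 1\<close> and therefore exponent sum \<open>e = 0\<close>.\<close>

lemma burau_eq_one_iff:
  fixes w :: "nat gword"
  assumes w: "w \<in> gwords {1..<n}" and "n > 0"
  shows "burau n (pres_class {1..<n} (braid_rels n) w) = (1\<^sub>m n :: 'k :: field_char_0 poly fract mat)
    \<longleftrightarrow> exponent_sum w = 0 \<and> burau_trivial n w"
proof -
  let ?q = "qvar :: 'k poly fract" and ?s = "burau_param :: 'k poly fract"
  have w': "w \<in> gwords {0<..}" using w by (auto simp: gwords_def)
  have "gword_eval (GL n) (burau_gen n :: nat \<Rightarrow> 'k poly fract mat) w \<in> carrier_mat n n"
    by (intro GL_carrierD gword_eval_closed[OF group_GL _ w] funcsetI burau_gen_closed)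
  hence iff: "burau n (pres_class {1..<n} (braid_rels n) w) = (1\<^sub>m n :: 'k poly fract mat) \<longleftrightarrow>
      (\<forall>x. \<forall>b<n. ?q powi exponent_sum w * burau_colour ?s w x b = x b)"
    unfolding burau_pres_class[OF w] by (rule acts_as_eq_one_iff[OF _ acts_as_burau[OF w]])
  show ?thesis
  proof
    assume "burau n (pres_class {1..<n} (braid_rels n) w) = (1\<^sub>m n :: 'k poly fract mat)"
    hence id: "?q powi exponent_sum w * burau_colour ?s w x b = x b" if "b < n" for x b
      using that iff by blast
    have "burau_colour ?s w (\<lambda>_. 1) = (\<lambda>_. 1)"
      using burau_param_nonzero[where 'a = 'k] by (intro colour_fixed[OF w]) (simp add: aff_def affinv_def)
    with id[of 0 "\<lambda>_. 1"] \<open>n > 0\<close> have e: "exponent_sum w = 0" using qvar_powi_eq_1 by simp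
    have "burau_trivial n w"
    proof (rule burau_trivialI[OF _ w', of ?s])
      show "P = 0" if "peval ?s P = 0" for P
        using peval_qvar_inverse_eq_0[of 2 P, where 'k = 'k] that by (simp add: burau_param_def)
      show "burau_colour ?s w (unit_seq p) b = unit_seq p b" if "b < n" for p b
        using id[OF that] e by simp
    qed
    with e show "exponent_sum w = 0 \<and> burau_trivial n w" by simp
  next
    assume triv: "exponent_sum w = 0 \<and> burau_trivial n w"
    have "burau_colour ?s w x b = x b" if b: "b < n" for x b
    proof -
      have "burau_colour ?s w x b = (\<Sum>p<n. x p * unit_seq p b)"
        unfolding burau_colour_expand[OF w b, of ?s x]
        using triv b by (intro sum.cong HOL.refl) (simp add: burau_trivialD[OF _ burau_param_nonzero w', of n])
      also have "\<dots> = x b" using burau_colour_expand[of "[]" n b ?s x] b by simp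
      finally show ?thesis .
    qed
    thus "burau n (pres_class {1..<n} (braid_rels n) w) = (1\<^sub>m n :: 'k poly fract mat)"
      using triv iff by simp
  qed
qed

lemma hom_gword_eval:
  assumes "group G" "group H" "h \<in> hom G H" "f \<in> S \<rightarrow> carrier G"
  shows "w \<in> gwords S \<Longrightarrow> h (gword_eval G f w) = gword_eval H (\<lambda>s. h (f s)) w"
proof (induction w)
  case Nil
  show ?case using hom_one[OF assms(3,1,2)] by simp
next
  case (Cons l w)
  interpret group_hom G H h using assms by (simp add: group_hom_def group_hom_axioms_def)
  obtain s e where l: "l = (s, e)" by (cases l)
  have "f s \<in> carrier G" "gword_eval G f w \<in> carrier G"
    using Cons.prems assms(4) gword_eval_closed[OF assms(1,4)] l by auto
  with Cons show ?case by (auto simp: l)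
qed

lemma burau_cabling_pres_class:
  assumes "w \<in> gwords {1..<n}"
  shows "burau (n * r) (cabling n r (pres_class {1..<n} (braid_rels n) w)) =
    gword_eval (GL (n * r))
      (\<lambda>i. gword_eval (GL (n * r)) (burau_gen (n * r) :: nat \<Rightarrow> 'k :: field poly fract mat) (pos_word (cable_word r i))) w"
proof -
  have "burau (n * r) (cabling n r (pres_class {1..<n} (braid_rels n) w)) =
      (burau (n * r) (gword_eval (braid_group (n * r)) (\<lambda>i. pos_braid (n * r) (cable_word r i)) w) :: 'k poly fract mat)"
    unfolding cabling_def
    by (subst presented_lift_class[OF group_braid cable_closed cable_respects assms]) auto
  also have "\<dots> = gword_eval (GL (n * r)) (\<lambda>i. burau (n * r) (pos_braid (n * r) (cable_word r i))) w"
    by (rule hom_gword_eval[OF group_braid group_GL burau_hom cable_closed assms])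
  also have "\<dots> = gword_eval (GL (n * r)) (\<lambda>i. gword_eval (GL (n * r)) (burau_gen (n * r)) (pos_word (cable_word r i))) w"
    using assms
  proof (induction w)
    case (Cons l w)
    obtain i e where l: "l = (i, e)" by (cases l)
    have "burau (n * r) (pos_braid (n * r) (cable_word r i)) =
        gword_eval (GL (n * r)) (burau_gen (n * r) :: nat \<Rightarrow> 'k poly fract mat) (pos_word (cable_word r i))"
      using Cons.prems l cable_sub[of i n r] unfolding pos_braid_def by (intro burau_pres_class) auto
    with Cons show ?case by (simp add: l)
  qed simp
  finally show ?thesis .
qed

lemma exponent_sum_pos_word [simp]: "exponent_sum (pos_word xs) = int (length xs)"
  by (induction xs) simp_all

lemma length_cable_word: "length (cable_word r i) = r * r"
  by (simp add: cable_word_def length_concat comp_def descending_def sum_list_triv)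

lemma acts_as_cabling:
  fixes w :: "nat gword"
  assumes w: "w \<in> gwords {1..<n}"
  shows "acts_as (n * r) (burau (n * r) (cabling n r (pres_class {1..<n} (braid_rels n) w)) :: 'k :: field poly fract mat)
    (\<lambda>x b. (qvar ^ (r * r)) powi exponent_sum w * fold (cable_cross burau_param r) w x b)"
proof -
  let ?f = "\<lambda>i. gword_eval (GL (n * r)) (burau_gen (n * r) :: nat \<Rightarrow> 'k poly fract mat) (pos_word (cable_word r i))"
  let ?c = "qvar ^ (r * r) :: 'k poly fract"
  have c: "?c \<noteq> 0" using qvar_nonzero[where 'k = 'k] by simp
  have scale: "cable_cross s r l (\<lambda>b. k * x b) = (\<lambda>b. k * cable_cross s r l x b)" for s k :: "'k poly fract" and l x
    unfolding cable_cross_def by (intro colour_natural) (simp_all add: aff_def affinv_def algebra_simps)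
  let ?T = "\<lambda>l x b. ?c powi (if snd l then 1 else - 1) * cable_cross burau_param r l x b"
  have "acts_as (n * r) (gword_eval (GL (n * r)) ?f w) (fold ?T w)"
  proof (rule acts_as_gword_eval[OF _ _ _ w])
    show "?f \<in> {1..<n} \<rightarrow> carrier (GL (n * r) :: 'k poly fract mat monoid)"
      by (intro funcsetI gword_eval_closed[OF group_GL, where S = "{1..<n * r}"] burau_gen_closed)
        (use cable_sub in \<open>simp_all only: pos_word_gwords\<close>)
    fix i assume i: "i \<in> {1..<n}"
    have "acts_as (n * r) (?f i) (\<lambda>x b. qvar powi exponent_sum (pos_word (cable_word r i)) * burau_colour burau_param (pos_word (cable_word r i)) x b)"
      using cable_sub[OF i, of r] by (intro acts_as_burau) simp
    thus "acts_as (n * r) (?f i) (?T (i, True))"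
      by (simp add: length_cable_word cable_cross_def flip: of_nat_mult)
    show "?T (i, True) (?T (i, False) x) b = x b" for x b
      using i c cable_cross_inverse[of i burau_param r x] burau_param_nonzero[where 'a = 'k] by (simp add: scale)
  qed
  thus ?thesis
    unfolding burau_cabling_pres_class[OF w] by (simp add: acts_as_def fold_scaled[OF c scale])
qed

text \<open>For the forward direction only sequences that are constant on blocks are used: their deviations vanish,
leaving the colouring at \<open>s\<^sup>r\<close>, which is again a transcendental parameter. Conversely, a generically trivial colouring makes
the means invariant, and the deviations are invariant by the derivative argument.\<close>

lemma burau_cabling_eq_one_iff:
  fixes w :: "nat gword"
  assumes w: "w \<in> gwords {1..<n}" and "n > 0" "r > 0"
  shows "burau (n * r) (cabling n r (pres_class {1..<n} (braid_rels n) w)) = (1\<^sub>m (n * r) :: 'k :: field_char_0 poly fract mat)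
    \<longleftrightarrow> exponent_sum w = 0 \<and> burau_trivial n w"
proof -
  let ?q = "qvar :: 'k poly fract" and ?s = "burau_param :: 'k poly fract"
  let ?t = "?s ^ r"
  have w': "w \<in> gwords {0<..}" using w by (auto simp: gwords_def)
  have t_eq: "?t = inverse (?q ^ (2 * r))" by (simp add: burau_param_def power_inverse power_mult)
  have trans: "P = 0" if "peval ?t P = 0" for P
    using peval_qvar_inverse_eq_0[of "2 * r" P, where 'k = 'k] that \<open>r > 0\<close> by (simp add: t_eq)
  have t0: "?t \<noteq> 0" using burau_param_nonzero[where 'a = 'k] by simp
  have t1: "?t \<noteq> 1" using trans[of "[:- 1, 1:]"] by auto
  have "burau (n * r) (cabling n r (pres_class {1..<n} (braid_rels n) w)) \<in> carrier (GL (n * r) :: 'k poly fract mat monoid)"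
    using w by (intro hom_in_carrier[OF burau_hom] hom_in_carrier[OF cabling_hom])
      (simp add: braid_group_def pres_class_carrier)
  hence iff: "burau (n * r) (cabling n r (pres_class {1..<n} (braid_rels n) w)) = (1\<^sub>m (n * r) :: 'k poly fract mat) \<longleftrightarrow>
      (\<forall>x. \<forall>b<n * r. (?q ^ (r * r)) powi exponent_sum w * fold (cable_cross ?s r) w x b = x b)"
    by (intro acts_as_eq_one_iff GL_carrierD acts_as_cabling[OF w])
  note fold = fold_cable_cross[OF w' t1 burau_param_nonzero]
  show ?thesis
  proof
    assume "burau (n * r) (cabling n r (pres_class {1..<n} (braid_rels n) w)) = (1\<^sub>m (n * r) :: 'k poly fract mat)"
    hence id: "(?q ^ (r * r)) powi exponent_sum w * fold (cable_cross ?s r) w x b = x b" if "b < n * r" for x b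
      using that iff by blast
    have id': "(?q ^ (r * r)) powi exponent_sum w * burau_colour ?t w y i = y i" if i: "i < n" for y i
    proof -
      let ?x = "\<lambda>c. y (c div r)"
      have mean: "block_mean ?s r ?x = y"
      proof
        fix j show "block_mean ?s r ?x j = y j"
          using block_mean_affine[OF t1, of ?x j 0 ?x j "y j"] by simp
      qed
      have "block_dev ?s r 0 ?x = (\<lambda>_. 0)"
        using \<open>r > 0\<close> by (simp add: block_dev_def mean fun_eq_iff)
      moreover have "mono_colour ?t w (\<lambda>_. 0) = (\<lambda>_. 0)"
        by (intro colour_fixed[OF w]) simp
      ultimately have "fold (cable_cross ?s r) w ?x (r * i + 0) = burau_colour ?t w y i"
        using fold[OF \<open>r > 0\<close>, of ?x i] by (simp add: mean)
      moreover have "r * i + 0 < n * r" using i \<open>r > 0\<close> by simp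
      ultimately show ?thesis using id[of "r * i + 0" ?x] \<open>r > 0\<close> by simp
    qed
    have "burau_colour ?t w (\<lambda>_. 1) = (\<lambda>_. 1)"
      using t0 by (intro colour_fixed[OF w]) (simp add: aff_def affinv_def)
    with id'[of 0 "\<lambda>_. 1"] \<open>n > 0\<close> have "?q powi (int (r * r) * exponent_sum w) = 1"
      by (simp add: power_int_mult del: of_nat_mult)
    hence e: "exponent_sum w = 0" using qvar_powi_eq_1 \<open>r > 0\<close> by fastforce
    have "burau_trivial n w"
      using id' e by (intro burau_trivialI[OF trans w']) auto
    with e show "exponent_sum w = 0 \<and> burau_trivial n w" by simp
  next
    assume triv: "exponent_sum w = 0 \<and> burau_trivial n w"
    have col: "burau_colour ?t w y i = y i" if i: "i < n" for y i
    proof -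
      have "burau_colour ?t w y i = (\<Sum>p<n. y p * unit_seq p i)"
        unfolding burau_colour_expand[OF w i, of ?t y]
        using triv i by (intro sum.cong HOL.refl) (simp add: burau_trivialD[OF _ t0 w', of n])
      also have "\<dots> = y i" using burau_colour_expand[of "[]" n i ?t y] i by simp
      finally show ?thesis .
    qed
    have mono: "mono_colour ?t w y i = y i" if "i < n" for y i
      using burau_trivial_track[OF _ w' that] triv by (simp add: mono_colour_track[OF t0])
    have "fold (cable_cross ?s r) w x b = x b" if b: "b < n * r" for x b
    proof -
      have i: "b div r < n" "b mod r < r" using b \<open>r > 0\<close> by (simp_all add: less_mult_imp_div_less)
      have "fold (cable_cross ?s r) w x (r * (b div r) + b mod r) = x (r * (b div r) + b mod r)"
        unfolding fold[OF i(2)] col[OF i(1)] mono[OF i(1)] by (simp add: block_dev_def)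
      thus ?thesis by simp
    qed
    thus "burau (n * r) (cabling n r (pres_class {1..<n} (braid_rels n) w)) = (1\<^sub>m (n * r) :: 'k poly fract mat)"
      using triv iff by simp
  qed
qed

section \<open>Bigelow's braid\<close>

text \<open>The conjugating words of S. Bigelow, "The Burau representation is not faithful for n = 5" (1999). The conjugates
\<open>bigelow_A\<close> and \<open>bigelow_B\<close> of two simple braids do not commute in \<open>B\<^sub>5\<close>, but their Burau matrices do.\<close>

definition bigelow_psi1 :: "nat gword" where
  "bigelow_psi1 = (3, False) # pos_word [2, 1, 1, 2, 4, 4, 4, 3, 2]"

definition bigelow_psi2 :: "nat gword" where
  "bigelow_psi2 = (4, False) # pos_word [3, 2] @ [(1, False), (1, False)] @
     pos_word [2, 1, 1, 2, 2, 1, 4, 4, 4, 4, 4]"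

definition bigelow_A :: "nat gword" where
  "bigelow_A = gword_inv bigelow_psi1 @ pos_word [4] @ bigelow_psi1"

definition bigelow_B :: "nat gword" where
  "bigelow_B = gword_inv bigelow_psi2 @ pos_word [4, 3, 2, 1, 1, 2, 3, 4] @ bigelow_psi2"

definition bigelow :: "nat gword" where
  "bigelow = bigelow_A @ bigelow_B @ gword_inv bigelow_A @ gword_inv bigelow_B"

lemmas bigelow_letters = bigelow_A_def bigelow_B_def bigelow_psi1_def bigelow_psi2_def gword_inv_def

lemma bigelow_gwords: "bigelow_A \<in> gwords {1..<5}" "bigelow_B \<in> gwords {1..<5}"
  by (simp_all add: bigelow_letters)

text \<open>Bigelow's braid only moves the first five positions; this normal form of a sequence lets the simplifier evaluate
colourings, with \<open>z\<close> as the colour of all other strands.\<close>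

definition quint :: "'a \<Rightarrow> 'a \<Rightarrow> 'a \<Rightarrow> 'a \<Rightarrow> 'a \<Rightarrow> 'a \<Rightarrow> nat \<Rightarrow> 'a" where
  "quint z a b c d e k =
     (if k = 0 then a else if k = 1 then b else if k = 2 then c else if k = 3 then d else if k = 4 then e else z)"

lemma cross_quint:
  "cross f g (Suc 0, True) (quint z a b c d e) = quint z (f a b) a c d e"
  "cross f g (2, True) (quint z a b c d e) = quint z a (f b c) b d e"
  "cross f g (3, True) (quint z a b c d e) = quint z a b (f c d) c e"
  "cross f g (4, True) (quint z a b c d e) = quint z a b c (f d e) d"
  "cross f g (Suc 0, False) (quint z a b c d e) = quint z b (g b a) c d e"
  "cross f g (2, False) (quint z a b c d e) = quint z a c (g c b) d e"
  "cross f g (3, False) (quint z a b c d e) = quint z a b d (g d c) e"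
  "cross f g (4, False) (quint z a b c d e) = quint z a b c e (g e d)"
  by (auto simp: cross_def quint_def fun_eq_iff)

lemma poly_cross_quint:
  "poly_cross (Suc 0, True) (quint 0 a b c d e) = quint 0 (a + pCons 0 (b - a)) a c d e"
  "poly_cross (2, True) (quint 0 a b c d e) = quint 0 a (b + pCons 0 (c - b)) b d e"
  "poly_cross (3, True) (quint 0 a b c d e) = quint 0 a b (c + pCons 0 (d - c)) c e"
  "poly_cross (4, True) (quint 0 a b c d e) = quint 0 a b c (d + pCons 0 (e - d)) d"
  "poly_cross (Suc 0, False) (quint 0 a b c d e) =
     quint 0 (pCons 0 b) (a - b + pCons 0 b) (pCons 0 c) (pCons 0 d) (pCons 0 e)"
  "poly_cross (2, False) (quint 0 a b c d e) =
     quint 0 (pCons 0 a) (pCons 0 c) (b - c + pCons 0 c) (pCons 0 d) (pCons 0 e)"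
  "poly_cross (3, False) (quint 0 a b c d e) =
     quint 0 (pCons 0 a) (pCons 0 b) (pCons 0 d) (c - d + pCons 0 d) (pCons 0 e)"
  "poly_cross (4, False) (quint 0 a b c d e) =
     quint 0 (pCons 0 a) (pCons 0 b) (pCons 0 c) (pCons 0 e) (d - e + pCons 0 e)"
  by (auto simp: poly_cross_def quint_def fun_eq_iff)

text \<open>A computation with the \<open>5 \<times> 5\<close> Burau matrices, one row at a time. Commutation of the two halves avoids the longer
words with the inverses.\<close>

lemma bigelow_poly_commute:
  "fold poly_cross (bigelow_A @ bigelow_B) (quint 0 [:1:] 0 0 0 0)
    = fold poly_cross (bigelow_B @ bigelow_A) (quint 0 [:1:] 0 0 0 0)"
  "fold poly_cross (bigelow_A @ bigelow_B) (quint 0 0 [:1:] 0 0 0)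
    = fold poly_cross (bigelow_B @ bigelow_A) (quint 0 0 [:1:] 0 0 0)"
  "fold poly_cross (bigelow_A @ bigelow_B) (quint 0 0 0 [:1:] 0 0)
    = fold poly_cross (bigelow_B @ bigelow_A) (quint 0 0 0 [:1:] 0 0)"
  "fold poly_cross (bigelow_A @ bigelow_B) (quint 0 0 0 0 [:1:] 0)
    = fold poly_cross (bigelow_B @ bigelow_A) (quint 0 0 0 0 [:1:] 0)"
  "fold poly_cross (bigelow_A @ bigelow_B) (quint 0 0 0 0 0 [:1:])
    = fold poly_cross (bigelow_B @ bigelow_A) (quint 0 0 0 0 0 [:1:])"
  by (simp_all add: bigelow_letters poly_cross_quint)

lemma unit_seq_quint:
  assumes "p < 5"
  shows "(unit_seq p :: nat \<Rightarrow> int poly) \<in> {quint 0 [:1:] 0 0 0 0, quint 0 0 [:1:] 0 0 0, quint 0 0 0 [:1:] 0 0,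
    quint 0 0 0 0 [:1:] 0, quint 0 0 0 0 0 [:1:]}"
proof -
  consider "p = 0" | "p = 1" | "p = 2" | "p = 3" | "p = 4" using assms by linarith
  moreover have "unit_seq 0 = quint 0 [:1 :: int:] 0 0 0 0" "unit_seq 1 = quint 0 0 [:1 :: int:] 0 0 0"
    "unit_seq 2 = quint 0 0 0 [:1 :: int:] 0 0" "unit_seq 3 = quint 0 0 0 0 [:1 :: int:] 0"
    "unit_seq 4 = quint 0 0 0 0 0 [:1 :: int:]"
    by (auto simp: fun_eq_iff unit_seq_def quint_def)
  ultimately show ?thesis by cases auto
qed

lemma bigelow_burau_commute:
  fixes s :: "'a :: field"
  assumes "s \<noteq> 0"
  shows "burau_colour s (bigelow_A @ bigelow_B) (unit_seq p) = burau_colour s (bigelow_B @ bigelow_A) (unit_seq p)"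
proof (cases "p < 5")
  case True
  have "fold poly_cross (bigelow_A @ bigelow_B) (unit_seq p) = fold poly_cross (bigelow_B @ bigelow_A) (unit_seq p)"
    using unit_seq_quint[OF True] bigelow_poly_commute by auto
  moreover have "bigelow_A @ bigelow_B \<in> gwords {0<..}" "bigelow_B @ bigelow_A \<in> gwords {0<..}"
    by (simp_all add: bigelow_letters)
  ultimately have "s ^ neg_letters (bigelow_A @ bigelow_B) * burau_colour s (bigelow_A @ bigelow_B) (unit_seq p) b =
      s ^ neg_letters (bigelow_B @ bigelow_A) * burau_colour s (bigelow_B @ bigelow_A) (unit_seq p) b" for b
    using peval_fold_poly_cross[OF assms, of _ "unit_seq p" b] unfolding peval_unit_seq by metis
  thus ?thesis using assms by (auto simp: neg_letters_def add.commute fun_eq_iff simp del: colour_simps)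
next
  case False
  have "burau_colour s w (unit_seq p) = unit_seq p" if "w \<in> gwords {1..<5}" for w
    using False assms by (intro colour_fixed[OF that]) (auto simp: unit_seq_def aff_def affinv_def)
  thus ?thesis using bigelow_gwords by simp
qed

lemma exponent_sum_gword_inv [simp]: "exponent_sum (gword_inv w) = - exponent_sum w"
  by (induction w) (auto simp: gword_inv_def exponent_sum_def)

text \<open>Any transcendental parameter may be used, since the conclusion is a statement about integer polynomials.\<close>

lemma burau_trivial_bigelow: "burau_trivial n bigelow"
proof (rule burau_trivialI[where s = "burau_param :: rat poly fract"])
  show "P = 0" if "peval (burau_param :: rat poly fract) P = 0" for P
    using peval_qvar_inverse_eq_0[of 2 P, where 'k = rat] that by (simp add: burau_param_def)
  show "bigelow \<in> gwords {0<..}" 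
    by (simp add: bigelow_def) (simp add: bigelow_letters)
  fix p b
  interpret rack "aff (burau_param :: rat poly fract)" "affinv burau_param" by (rule rack_aff[OF burau_param_nonzero])
  have BA: "bigelow_A \<in> gwords {0<..}" "bigelow_B \<in> gwords {0<..}" by (simp_all add: bigelow_letters)
  show "burau_colour (burau_param :: rat poly fract) bigelow (unit_seq p) b = unit_seq p b"
    using bigelow_burau_commute[OF burau_param_nonzero[where 'a = rat], of p]
    by (simp add: bigelow_def colour_inverse BA)
qed

text \<open>Fox colourings \<open>2 a - b\<close>, where \<open>None\<close> marks strands that are deleted from the diagram. Deletion is essential: Fox
colourings of all strands are Alexander colourings with \<open>s = -1\<close>, which cannot see an element of the Burau kernel.\<close>

fun fox :: "int option \<Rightarrow> int option \<Rightarrow> int option" where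
  "fox (Some a) (Some b) = Some (2 * a - b)"
| "fox _ x = x"

lemma rack_fox: "rack fox fox"
proof -
  have "fox a (fox a b) = b" for a b by (cases a; cases b) simp_all
  thus ?thesis by unfold_locales
qed

lemma fox_distrib: "fox a (fox b c) = fox (fox a b) (fox a c)"
  by (cases a; cases b; cases c) simp_all

text \<open>The fifth strand is deleted, together with all strands from the sixth on. The starting colours were
found by a search over small integers.\<close>

lemma bigelow_fox:
  "colour fox fox bigelow (quint None (Some 0) (Some (- 1)) (Some (- 1)) (Some 0) None) =
    quint None (Some 16) (Some 15) (Some 15) (Some 16) None"
  by (simp add: bigelow_def bigelow_letters cross_quint)

lemma bigelow_nontrivial: "\<not> pres_eq {1..<n} (braid_rels n) bigelow []"
proof
  assume "pres_eq {1..<n} (braid_rels n) bigelow []"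
  hence "colour fox fox bigelow = colour fox fox []"
    by (rule rack.colour_pres_eq[OF rack_fox fox_distrib])
  hence "colour fox fox bigelow x 0 = x 0" for x by simp
  from this[of "quint None (Some 0) (Some (- 1)) (Some (- 1)) (Some 0) None"] show False
    unfolding bigelow_fox by (simp add: quint_def)
qed

section \<open>Kernel of the cabled Burau representation\<close>

theorem mainTheorem2:
  fixes n r :: nat
  assumes "n \<ge> 3" and "r \<ge> 1"
  shows "kernel (braid_group n) (GL (n * r))
           ((burau (n * r) :: braid \<Rightarrow> 'k :: field_char_0 poly fract mat) \<circ> cabling n r)
         = kernel (braid_group n) (GL n) (burau n :: braid \<Rightarrow> 'k poly fract mat)
       \<and> (n \<ge> 5 \<longrightarrow>
           \<not> inj_on ((burau (n * r) :: braid \<Rightarrow> 'k poly fract mat) \<circ> cabling n r)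
               (carrier (braid_group n)))"
proof (intro conjI impI)
  let ?cl = "pres_class {1..<n} (braid_rels n)"
  let ?R = "burau n :: braid \<Rightarrow> 'k poly fract mat"
  let ?C = "(burau (n * r) :: braid \<Rightarrow> 'k poly fract mat) \<circ> cabling n r"
  have nr: "n > 0" "r > 0" using assms by auto
  have same: "?C x = \<one>\<^bsub>GL (n * r)\<^esub> \<longleftrightarrow> ?R x = \<one>\<^bsub>GL n\<^esub>" if x: "x \<in> carrier (braid_group n)" for x
  proof -
    obtain w where w: "w \<in> gwords {1..<n}" "x = ?cl w"
      using x unfolding braid_group_def by (blast elim: presented_carrierE)
    show ?thesis
      unfolding w(2) comp_apply GL_simps burau_eq_one_iff[OF w(1) nr(1)] burau_cabling_eq_one_iff[OF w(1) nr] ..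
  qed
  thus "kernel (braid_group n) (GL (n * r)) ?C = kernel (braid_group n) (GL n) ?R"
    by (auto simp: kernel_def)
  assume "n \<ge> 5"
  hence sub: "bigelow_A \<in> gwords {1..<n}" "bigelow_B \<in> gwords {1..<n}"
    by (simp_all add: bigelow_letters)
  hence w: "bigelow \<in> gwords {1..<n}" by (simp add: bigelow_def)
  have one: "?C (?cl w) = 1\<^sub>m (n * r)" if "w \<in> gwords {1..<n}" "exponent_sum w = 0" "burau_trivial n w" for w
    using burau_cabling_eq_one_iff[OF that(1) nr] that(2,3) by simp
  have "exponent_sum bigelow = 0" by (simp add: bigelow_def)
  hence "?C (?cl bigelow) = ?C (?cl [])"
    using one[OF w] one[of "[]"] burau_trivial_bigelow by (simp add: burau_trivial_def neg_letters_def unit_seq_def monom_0)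
  moreover have "?cl bigelow \<noteq> ?cl []"
    using bigelow_nontrivial w by (simp add: pres_class_eq_iff)
  moreover have "?cl bigelow \<in> carrier (braid_group n)" "?cl [] \<in> carrier (braid_group n)"
    using w by (simp_all add: braid_group_def pres_class_carrier)
  ultimately show "\<not> inj_on ?C (carrier (braid_group n))"
    by (meson inj_onD)
qed

end
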